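(* Let $m,N_1,\ldots,N_m$ be natural numbers (positive integers), let $\mathcal{H}$ and $\mathcal{K}_{p,i}$ ($i=1,\ldots,N_p$, $p=1,\ldots,m$) be complex Hilbert spaces, and let $A_{p,i}:\mathcal{K}_{p,i}\to\mathcal{H}$, $i=1,\ldots,N_p$, $p=1,\ldots,m$, be bounded linear operators such that $A_{p,i}^*A_{q,j}$ is compact for any $p\neq q$, $i=1,\ldots,N_p$, $j=1,\ldots,N_q$. If $\mathcal{R}_p=\sum_{i=1}^{N_p}\mathrm{Ran}(A_{p,i})$ is closed in $\mathcal{H}$ for every $p=1,\ldots,m$, then $\sum_{p=1}^m\mathcal{R}_p$ is closed in $\mathcal{H}$.
   Context: $\mathrm{Ran}$ denotes the range of an operator; sums of ranges and of subspaces are algebraic sums, i.e. the set of all sums of elements one from each summand. *)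

theory Defs
  imports "HOL-Analysis.Analysis" "HOL-Algebra.Module" "HOL-Algebra.Algebraic_Closure_Type"
begin

text \<open>Complex Hilbert spaces are given on explicit carriers, so that a finite family of unrelated
  Hilbert spaces can be indexed by natural numbers. A complex vector space is a module over the
  complex field; the multiplicative fields \<open>mult\<close> and \<open>one\<close> which the record type inherits from
  rings carry no information and are left unconstrained.\<close>

record 'a cinner_space = "(complex, 'a) module" +
  cinner :: "'a \<Rightarrow> 'a \<Rightarrow> complex" (\<open>cinner\<index>\<close>)

definition cnorm :: "('a, 'm) cinner_space_scheme \<Rightarrow> 'a \<Rightarrow> real" where
  "cnorm V x = sqrt (Re (cinner\<^bsub>V\<^esub> x x))"

text \<open>The value 0 off the carrier is needed because \<^locale>\<open>Metric_space\<close> asks for nonnegativity and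
  symmetry on the whole type.\<close>

definition cdist :: "('a, 'm) cinner_space_scheme \<Rightarrow> 'a \<Rightarrow> 'a \<Rightarrow> real" where
  "cdist V x y =
     (if x \<in> carrier V \<and> y \<in> carrier V then cnorm V (x \<ominus>\<^bsub>V\<^esub> y) else 0)"

definition norm_topology :: "('a, 'm) cinner_space_scheme \<Rightarrow> 'a topology" where
  "norm_topology V = Metric_space.mtopology (carrier V) (cdist V)"

text \<open>The inner product is linear in its first argument.\<close>

locale complex_inner_space =
  Module.module "ring_of_type_algebra :: complex ring" V
  for V :: "('a, 'm) cinner_space_scheme" (structure) +
  assumes cinner_add_left:
      "\<lbrakk>x \<in> carrier V; y \<in> carrier V; z \<in> carrier V\<rbrakk>
        \<Longrightarrow> cinner (x \<oplus> y) z = cinner x z + cinner y z"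
    and cinner_smult_left:
      "\<lbrakk>x \<in> carrier V; y \<in> carrier V\<rbrakk> \<Longrightarrow> cinner (c \<odot> x) y = c * cinner x y"
    and cinner_commute:
      "\<lbrakk>x \<in> carrier V; y \<in> carrier V\<rbrakk> \<Longrightarrow> cinner y x = cnj (cinner x y)"
    and cinner_nonneg: "x \<in> carrier V \<Longrightarrow> 0 \<le> Re (cinner x x)"
    and cinner_eq_zeroD: "\<lbrakk>x \<in> carrier V; cinner x x = 0\<rbrakk> \<Longrightarrow> x = \<zero>"
begin

lemma smult_in_carrier: "x \<in> carrier V \<Longrightarrow> c \<odot> x \<in> carrier V"
  by (rule smult_closed) (simp_all add: ring_of_type_algebra_def)

lemma minus_eq_smult: "x \<in> carrier V \<Longrightarrow> \<ominus> x = (- 1) \<odot> x"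
proof -
  assume x: "x \<in> carrier V"
  have "(1 + (- 1)) \<odot> x = 1 \<odot> x \<oplus> (- 1) \<odot> x"
    using smult_l_distr[of 1 "- 1" x] x by (simp add: ring_of_type_algebra_def)
  moreover have "1 \<odot> x = x" "0 \<odot> x = \<zero>"
    using smult_one[OF x] smult_l_null[OF x] by (simp_all add: ring_of_type_algebra_def)
  ultimately have "x \<oplus> (- 1) \<odot> x = \<zero>" by simp
  then show ?thesis
    using x smult_in_carrier[OF x] by (metis M.add.inv_equality M.add.m_comm)
qed

lemma cinner_minus_left:
  assumes "x \<in> carrier V" "y \<in> carrier V" "z \<in> carrier V"
  shows "cinner (x \<ominus> y) z = cinner x z - cinner y z"
  using assms
  by (simp add: a_minus_def cinner_add_left minus_eq_smult cinner_smult_left smult_in_carrier)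

lemma cinner_add_right:
  assumes "x \<in> carrier V" "y \<in> carrier V" "z \<in> carrier V"
  shows "cinner z (x \<oplus> y) = cinner z x + cinner z y"
  using assms cinner_commute[of "x \<oplus> y" z] cinner_commute[of x z] cinner_commute[of y z]
  by (simp add: cinner_add_left)

lemma cinner_minus_right:
  assumes "x \<in> carrier V" "y \<in> carrier V" "z \<in> carrier V"
  shows "cinner z (x \<ominus> y) = cinner z x - cinner z y"
  using assms cinner_commute[of "x \<ominus> y" z] cinner_commute[of x z] cinner_commute[of y z]
  by (simp add: cinner_minus_left)

lemma cinner_smult_right:
  assumes "x \<in> carrier V" "y \<in> carrier V"
  shows "cinner x (c \<odot> y) = cnj c * cinner x y"
  using assms cinner_commute[of "c \<odot> y" x] cinner_commute[of y x]
  by (simp add: cinner_smult_left smult_in_carrier)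

lemma cinner_self: "x \<in> carrier V \<Longrightarrow> cinner x x = of_real ((cnorm V x)\<^sup>2)"
  using cinner_commute[of x x] cinner_nonneg[of x]
  by (simp add: cnorm_def complex_eq_iff)

lemma cnorm_nonneg: "x \<in> carrier V \<Longrightarrow> 0 \<le> cnorm V x"
  by (simp add: cnorm_def cinner_nonneg)

lemma cnorm_eq_zero_iff: "x \<in> carrier V \<Longrightarrow> cnorm V x = 0 \<longleftrightarrow> x = \<zero>"
  using cinner_eq_zeroD[of x] cinner_self[of x] cinner_minus_left[of x x \<zero>]
  by (auto simp: M.r_neg a_minus_def)

lemma Cauchy_Schwarz:
  assumes x: "x \<in> carrier V" and y: "y \<in> carrier V"
  shows "cmod (cinner x y) \<le> cnorm V x * cnorm V y"
proof (cases "cnorm V y = 0")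
  case True
  then have "y = \<zero>" using y cnorm_eq_zero_iff by blast
  then have "cinner x y = 0"
    using cinner_minus_right[of y y x] x y by (simp add: M.r_neg a_minus_def)
  then show ?thesis using True by simp
next
  case False
  define n c where "n = (cnorm V y)\<^sup>2" and "c = cinner x y"
  have n: "n > 0" using False by (simp add: n_def)
  define v where "v = x \<ominus> (c / of_real n) \<odot> y"
  have v: "v \<in> carrier V" using x y by (simp add: v_def smult_in_carrier)
  have "cinner v v = cinner x x - cnj (c / of_real n) * c
      - (c / of_real n) * (cnj c - cnj (c / of_real n) * of_real n)"
    using x y cinner_commute[OF x y] unfolding v_def
    by (simp add: cinner_minus_left cinner_minus_right cinner_smult_left cinner_smult_right
        smult_in_carrier cinner_self[OF y] flip: n_def c_def)
  also have "\<dots> = of_real ((cnorm V x)\<^sup>2 - (cmod c)\<^sup>2 / n)"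
    using n by (simp add: cinner_self[OF x] field_simps complex_mult_cnj cmod_power2)
  finally have "0 \<le> (cnorm V x)\<^sup>2 - (cmod c)\<^sup>2 / n"
    using cinner_nonneg[OF v] by simp
  then have "(cmod c)\<^sup>2 \<le> (cnorm V x * cnorm V y)\<^sup>2"
    using n by (simp add: field_simps n_def)
  then show ?thesis
    unfolding c_def by (rule power2_le_imp_le) (simp add: cnorm_nonneg x y)
qed

lemma cnorm_triangle:
  assumes x: "x \<in> carrier V" and y: "y \<in> carrier V"
  shows "cnorm V (x \<oplus> y) \<le> cnorm V x + cnorm V y"
proof (rule power2_le_imp_le)
  have "of_real ((cnorm V (x \<oplus> y))\<^sup>2) = cinner (x \<oplus> y) (x \<oplus> y)"
    using x y by (simp add: cinner_self)
  also have "\<dots> = cinner x x + cinner y y + (cinner x y + cnj (cinner x y))"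
    using x y cinner_commute[OF x y] by (simp add: cinner_add_left cinner_add_right)
  also have "\<dots> = of_real ((cnorm V x)\<^sup>2 + (cnorm V y)\<^sup>2 + 2 * Re (cinner x y))"
    using x y by (simp add: cinner_self complex_add_cnj)
  finally have "(cnorm V (x \<oplus> y))\<^sup>2 = (cnorm V x)\<^sup>2 + (cnorm V y)\<^sup>2 + 2 * Re (cinner x y)"
    by (simp only: of_real_eq_iff)
  also have "\<dots> \<le> (cnorm V x + cnorm V y)\<^sup>2"
    using Cauchy_Schwarz[OF x y] complex_Re_le_cmod[of "cinner x y"]
    by (simp add: power2_sum)
  finally show "(cnorm V (x \<oplus> y))\<^sup>2 \<le> (cnorm V x + cnorm V y)\<^sup>2" .
  show "0 \<le> cnorm V x + cnorm V y" by (simp add: cnorm_nonneg x y)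
qed

sublocale metric: Metric_space "carrier V" "cdist V"
proof
  fix x y
  show "0 \<le> cdist V x y" by (simp add: cdist_def cnorm_nonneg)
  show "cdist V x y = cdist V y x"
    by (simp add: cdist_def cnorm_def cinner_minus_left cinner_minus_right)
next
  fix x y assume xy: "x \<in> carrier V" "y \<in> carrier V"
  then have "(x \<ominus> y) \<oplus> y = x" by (simp add: a_minus_def M.a_assoc M.l_neg)
  then have "x \<ominus> y = \<zero> \<longleftrightarrow> x = y" using xy by (auto simp: a_minus_def M.r_neg)
  with xy show "cdist V x y = 0 \<longleftrightarrow> x = y"
    by (simp add: cdist_def cnorm_eq_zero_iff)
next
  fix x y z assume xyz: "x \<in> carrier V" "y \<in> carrier V" "z \<in> carrier V"
  have "(x \<ominus> y) \<oplus> (y \<ominus> z) = x \<ominus> z"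
    using xyz by (simp add: a_minus_def M.a_assoc M.r_neg1)
  then show "cdist V x z \<le> cdist V x y + cdist V y z"
    using xyz cnorm_triangle[of "x \<ominus> y" "y \<ominus> z"] by (simp add: cdist_def)
qed

end

locale complex_hilbert_space = complex_inner_space +
  assumes complete: "metric.mcomplete"

definition bounded_operator ::
  "('a, 'm) cinner_space_scheme \<Rightarrow> ('b, 'n) cinner_space_scheme \<Rightarrow> ('a \<Rightarrow> 'b) \<Rightarrow> bool" where
  "bounded_operator V W T \<longleftrightarrow>
     T \<in> carrier V \<rightarrow> carrier W \<and>
     (\<forall>x\<in>carrier V. \<forall>y\<in>carrier V. T (x \<oplus>\<^bsub>V\<^esub> y) = T x \<oplus>\<^bsub>W\<^esub> T y) \<and>
     (\<forall>c. \<forall>x\<in>carrier V. T (c \<odot>\<^bsub>V\<^esub> x) = c \<odot>\<^bsub>W\<^esub> T x) \<and>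
     (\<exists>C. \<forall>x\<in>carrier V. cnorm W (T x) \<le> C * cnorm V x)"

text \<open>For a bounded operator between Hilbert spaces the vector below exists and is unique by the
  Riesz representation theorem.\<close>

definition hilbert_adjoint ::
  "('a, 'm) cinner_space_scheme \<Rightarrow> ('b, 'n) cinner_space_scheme \<Rightarrow> ('a \<Rightarrow> 'b) \<Rightarrow> 'b \<Rightarrow> 'a" where
  "hilbert_adjoint V W T y =
     (THE x. x \<in> carrier V \<and> (\<forall>z\<in>carrier V. cinner\<^bsub>V\<^esub> z x = cinner\<^bsub>W\<^esub> (T z) y))"

definition compact_operator ::
  "('a, 'm) cinner_space_scheme \<Rightarrow> ('b, 'n) cinner_space_scheme \<Rightarrow> ('a \<Rightarrow> 'b) \<Rightarrow> bool" where
  "compact_operator V W T \<longleftrightarrow>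
     bounded_operator V W T \<and>
     compactin (norm_topology W)
       (norm_topology W closure_of (T ` {x \<in> carrier V. cnorm V x \<le> 1}))"

definition algebraic_sum ::
  "('a, 'm) cinner_space_scheme \<Rightarrow> 'i set \<Rightarrow> ('i \<Rightarrow> 'a set) \<Rightarrow> 'a set" where
  "algebraic_sum V I S = {finsum V f I | f. \<forall>i\<in>I. f i \<in> S i}"

end

theory Submission
  imports Defs
begin

text \<open>
  The ranges are added one index \<open>p\<close> at a time, so the heart is the sum of two closed subspaces
  \<open>S\<close> and \<open>T\<close>. By Baire's theorem every vector of a closed sum of operator ranges has preimages
  bounded by a multiple of its norm; hence compactness of the products \<open>A\<^sub>i\<^sup>* A\<^sub>j\<close> passes to the
  subspaces: every bounded sequence in \<open>T\<close> has a subsequence which is Cauchy as a sequence of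
  functionals on \<open>S\<close>. If \<open>s\<^sub>n + t\<^sub>n \<rightarrow> z\<close> with \<open>t\<^sub>n\<close> of almost minimal norm and \<open>(t\<^sub>n)\<close> is bounded, this
  makes \<open>s\<^sub>n\<close> and then \<open>t\<^sub>n\<close> converge along a subsequence. If it is unbounded, normalizing yields
  \<open>t\<^sub>n / \<parallel>t\<^sub>n\<parallel> \<rightarrow> t \<in> S \<inter> T\<close>, and moving \<open>\<parallel>t\<^sub>n\<parallel> t\<close> from the second to the first summand
  contradicts minimality.
\<close>

section \<open>Sums of two closed subspaces\<close>

text \<open>The obstacle is that the two subspaces may share nonzero vectors: a convergent sequence
  of sums can have divergent components, because a common vector can be shifted from one summand to
  the other. Choosing second components of almost minimal norm stands in for a projection away from
  the intersection. Closedness is used twice: limits of components stay in their subspaces, and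
  Baire's theorem becomes applicable. The latter is indispensable because compactness speaks of
  vectors in the spaces where the operators start, so a bounded vector of a subspace must first be
  given preimages of controlled norm. The induction closes up because a finished partial sum is
  again the sum of the ranges of one finite family, now indexed by pairs \<open>(p, i)\<close>:
  Baire's theorem applies to it afresh, and its products with the operators of the next group are
  among those assumed compact.\<close>

context complex_inner_space
begin

section \<open>Vector identities and norm estimates in an inner product space\<close>

lemma cinner_zero_left [simp]: "x \<in> carrier V \<Longrightarrow> cinner \<zero> x = 0"
  using cinner_minus_left[of x x x] by (simp add: a_minus_def M.r_neg)

lemma cinner_zero_right [simp]: "x \<in> carrier V \<Longrightarrow> cinner x \<zero> = 0"
  using cinner_minus_right[of x x x] by (simp add: a_minus_def M.r_neg)

lemma cnorm_zero [simp]: "cnorm V \<zero> = 0"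
  by (simp add: cnorm_eq_zero_iff)

lemmas cinner_linear = cinner_add_left cinner_add_right cinner_minus_left cinner_minus_right
  cinner_smult_left cinner_smult_right smult_in_carrier

lemma minus_eq_zero_iff: "x \<in> carrier V \<Longrightarrow> y \<in> carrier V \<Longrightarrow> x \<ominus> y = \<zero> \<longleftrightarrow> x = y"
  using metric.zero[of x y] cnorm_eq_zero_iff[of "x \<ominus> y"] by (simp add: cdist_def)

text \<open>Pairing \<open>x \<ominus> y\<close> with itself gives zero. This is the device for
  proving vector identities below: after pairing with an arbitrary \<open>z\<close>, the rules
  \<open>cinner_linear\<close> reduce them to arithmetic of complex numbers.\<close>

lemma cinner_ext:
  assumes "x \<in> carrier V" "y \<in> carrier V" "\<And>z. z \<in> carrier V \<Longrightarrow> cinner x z = cinner y z"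
  shows "x = y"
proof -
  have "cinner (x \<ominus> y) (x \<ominus> y) = 0"
    using assms(1,2) assms(3)[of "x \<ominus> y"] by (simp add: cinner_minus_left)
  then have "x \<ominus> y = \<zero>" using assms by (intro cinner_eq_zeroD) auto
  then show ?thesis using assms by (simp add: minus_eq_zero_iff)
qed

lemma minus_zero [simp]: "x \<in> carrier V \<Longrightarrow> x \<ominus> \<zero> = x"
  by (intro cinner_ext) (auto simp: cinner_linear)

lemma cnorm_smult: "x \<in> carrier V \<Longrightarrow> cnorm V (c \<odot> x) = cmod c * cnorm V x"
proof -
  assume x: "x \<in> carrier V"
  have "cinner (c \<odot> x) (c \<odot> x) = of_real ((cmod c)\<^sup>2 * (cnorm V x)\<^sup>2)"
    using x complex_norm_square[of c] by (simp add: cinner_linear cinner_self[of x] mult_ac)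
  then have "(cnorm V (c \<odot> x))\<^sup>2 = (cmod c * cnorm V x)\<^sup>2"
    using x cinner_self[of "c \<odot> x"] by (simp add: smult_in_carrier power_mult_distrib flip: of_real_mult of_real_power)
  then show ?thesis using x by (simp add: cnorm_nonneg smult_in_carrier)
qed

lemma cnorm_minus_commute:
  assumes "x \<in> carrier V" "y \<in> carrier V"
  shows "cnorm V (x \<ominus> y) = cnorm V (y \<ominus> x)"
  using assms by (simp add: cnorm_def cinner_linear)

lemma cnorm_minus_triangle:
  assumes "x \<in> carrier V" "y \<in> carrier V" "z \<in> carrier V"
  shows "cnorm V (x \<ominus> z) \<le> cnorm V (x \<ominus> y) + cnorm V (y \<ominus> z)"
  using assms metric.triangle[of x y z] by (simp add: cdist_def)

lemma cnorm_minus_le: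
  assumes "x \<in> carrier V" "y \<in> carrier V"
  shows "cnorm V (x \<ominus> y) \<le> cnorm V x + cnorm V y"
proof -
  have "\<ominus> y = (- 1) \<odot> y" using assms by (simp add: minus_eq_smult)
  then have "cnorm V (\<ominus> y) = cnorm V y" using assms by (simp add: cnorm_smult)
  then show ?thesis using cnorm_triangle[of x "\<ominus> y"] assms by (simp add: a_minus_def)
qed

text \<open>Since \<open>cinner x x\<close> is the square of the norm, one factor
  \<open>cnorm V x\<close> cancels. It turns estimates of a vector paired with itself into norm
  bounds.\<close>

lemma cnorm_leI:
  assumes x: "x \<in> carrier V" and "cmod (cinner x x) \<le> c * cnorm V x" and "0 \<le> c"
  shows "cnorm V x \<le> c"
proof (cases "cnorm V x = 0")
  case False
  then have "cnorm V x > 0" using cnorm_nonneg[OF x] by simp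
  then show ?thesis using assms(2) by (simp add: cinner_self[OF x] power2_eq_square norm_mult)
qed (use assms in simp)

section \<open>Limits and closed sets described by sequences\<close>

lemma limitin_norm_topology_iff:
  assumes "\<And>n. f n \<in> carrier V"
  shows "limitin (norm_topology V) f l sequentially \<longleftrightarrow>
    l \<in> carrier V \<and> (\<lambda>n. cnorm V (f n \<ominus> l)) \<longlonglongrightarrow> 0"
  using assms cnorm_nonneg
  by (auto simp: norm_topology_def metric.limit_metric_sequentially LIMSEQ_iff cdist_def)

lemma closedin_norm_topology_iff:
  "closedin (norm_topology V) S \<longleftrightarrow> S \<subseteq> carrier V \<and>
    (\<forall>f l. (\<forall>n. f n \<in> S) \<and> l \<in> carrier V \<and> (\<lambda>n. cnorm V (f n \<ominus> l)) \<longlonglongrightarrow> 0 \<longrightarrow> l \<in> S)"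
proof -
  have "closedin (norm_topology V) S \<longleftrightarrow> S \<subseteq> carrier V \<and>
      (\<forall>f l. range f \<subseteq> S \<and> limitin (norm_topology V) f l sequentially \<longrightarrow> l \<in> S)"
    by (simp add: norm_topology_def metric.metric_closedin_iff_sequentially_closed)
  also have "\<dots> \<longleftrightarrow> S \<subseteq> carrier V \<and>
      (\<forall>f l. range f \<subseteq> S \<and> l \<in> carrier V \<and> (\<lambda>n. cnorm V (f n \<ominus> l)) \<longlonglongrightarrow> 0 \<longrightarrow> l \<in> S)"
    by (intro conj_cong refl all_cong1) (auto simp: limitin_norm_topology_iff image_subset_iff subset_iff)
  finally show ?thesis by (simp add: image_subset_iff)
qed

lemma closedin_limit:
  assumes "closedin (norm_topology V) S" "\<And>n. f n \<in> S" "l \<in> carrier V"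
    "(\<lambda>n. cnorm V (f n \<ominus> l)) \<longlonglongrightarrow> 0"
  shows "l \<in> S"
  using assms closedin_norm_topology_iff[of S] by blast

lemma cnorm_limit_unique:
  assumes f: "\<And>n. f n \<in> carrier V" and lk: "l \<in> carrier V" "k \<in> carrier V"
    and "(\<lambda>n. cnorm V (f n \<ominus> l)) \<longlonglongrightarrow> 0" "(\<lambda>n. cnorm V (f n \<ominus> k)) \<longlonglongrightarrow> 0"
  shows "l = k"
proof -
  have "(\<lambda>n. cnorm V (f n \<ominus> l) + cnorm V (f n \<ominus> k)) \<longlonglongrightarrow> 0"
    using tendsto_add[OF assms(4,5)] by simp
  moreover have "cnorm V (l \<ominus> k) \<le> cnorm V (f n \<ominus> l) + cnorm V (f n \<ominus> k)" for n
    using cnorm_minus_triangle[of l "f n" k] cnorm_minus_commute[of l "f n"] f lk by simp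
  ultimately have "cnorm V (l \<ominus> k) \<le> 0"
    by (intro LIMSEQ_le_const) auto
  then have "cnorm V (l \<ominus> k) = 0" using cnorm_nonneg[of "l \<ominus> k"] lk by simp
  then show ?thesis using lk by (simp add: cnorm_eq_zero_iff minus_eq_zero_iff)
qed

lemma convergent_Cauchy:
  assumes f: "\<And>n. f n \<in> carrier V" and l: "l \<in> carrier V"
    and lim: "(\<lambda>n. cnorm V (f n \<ominus> l)) \<longlonglongrightarrow> 0" and e: "e > 0"
  shows "\<exists>N. \<forall>j\<ge>N. \<forall>k\<ge>N. cnorm V (f j \<ominus> f k) < e"
proof -
  obtain N where N: "\<And>k. k \<ge> N \<Longrightarrow> cnorm V (f k \<ominus> l) < e/2"
    using lim e cnorm_nonneg f l by (fastforce simp: LIMSEQ_iff dest: spec[of _ "e/2"])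
  have "cnorm V (f j \<ominus> f k) < e" if "j \<ge> N" "k \<ge> N" for j k
    using cnorm_minus_triangle[of "f j" l "f k"] cnorm_minus_commute[of l "f k"]
      N[OF that(1)] N[OF that(2)] f l by simp
  then show ?thesis by blast
qed

lemma cnorm_add_minus_add:
  assumes "a \<in> carrier V" "b \<in> carrier V" "c \<in> carrier V" "d \<in> carrier V"
  shows "cnorm V ((a \<oplus> b) \<ominus> (c \<oplus> d)) \<le> cnorm V (a \<ominus> c) + cnorm V (b \<ominus> d)"
proof -
  have "(a \<oplus> b) \<ominus> (c \<oplus> d) = (a \<ominus> c) \<oplus> (b \<ominus> d)"
    using assms by (intro cinner_ext) (auto simp: cinner_linear)
  then show ?thesis using assms cnorm_triangle[of "a \<ominus> c" "b \<ominus> d"] by simp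
qed

definition csubspace :: "'a set \<Rightarrow> bool" where
  "csubspace S \<longleftrightarrow> S \<subseteq> carrier V \<and> \<zero> \<in> S \<and> (\<forall>x\<in>S. \<forall>y\<in>S. x \<oplus> y \<in> S) \<and> (\<forall>c. \<forall>x\<in>S. c \<odot> x \<in> S)"

lemma csubspaceD:
  assumes "csubspace S"
  shows "x \<in> S \<Longrightarrow> x \<in> carrier V" "\<zero> \<in> S" "x \<in> S \<Longrightarrow> y \<in> S \<Longrightarrow> x \<oplus> y \<in> S"
    "x \<in> S \<Longrightarrow> c \<odot> x \<in> S"
  using assms by (auto simp: csubspace_def)

lemma csubspace_minus: "csubspace S \<Longrightarrow> x \<in> S \<Longrightarrow> y \<in> S \<Longrightarrow> x \<ominus> y \<in> S"
  by (simp add: a_minus_def minus_eq_smult csubspaceD)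

end

context complex_hilbert_space
begin

lemma Cauchy_convergent:
  assumes f: "\<And>n. f n \<in> carrier V"
    and "\<And>e. e > 0 \<Longrightarrow> \<exists>N. \<forall>k\<ge>N. \<forall>l\<ge>N. cnorm V (f k \<ominus> f l) < e"
  obtains x where "x \<in> carrier V" "(\<lambda>n. cnorm V (f n \<ominus> x)) \<longlonglongrightarrow> 0"
proof -
  have "metric.MCauchy f"
    using f assms(2) by (fastforce simp: metric.MCauchy_def cdist_def image_subset_iff)
  then have "\<exists>x. limitin (norm_topology V) f x sequentially"
    using complete by (simp add: metric.mcomplete_def norm_topology_def)
  then show ?thesis using that limitin_norm_topology_iff[OF f] by auto
qed

text \<open>The \<open>S\<close>-component is controlled by \<open>\<parallel>s\<^sub>k - s\<^sub>l\<parallel>\<^sup>2 = \<langle>s\<^sub>k - s\<^sub>l, z\<^sub>k - z\<^sub>l\<rangle> - \<langle>s\<^sub>k - s\<^sub>l, t\<^sub>k - t\<^sub>l\<rangle>\<close>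
  for \<open>z = s + t\<close>.\<close>

lemma sum_components_converge:
  assumes S: "csubspace S" "closedin (norm_topology V) S"
    and T: "csubspace T" "closedin (norm_topology V) T"
    and s: "\<And>n. s n \<in> S" and t: "\<And>n. t n \<in> T"
    and z: "\<And>e. e > 0 \<Longrightarrow> \<exists>N. \<forall>k\<ge>N. \<forall>l\<ge>N. cnorm V ((s k \<oplus> t k) \<ominus> (s l \<oplus> t l)) < e"
    and C: "\<And>e. e > 0 \<Longrightarrow> \<exists>N. \<forall>k\<ge>N. \<forall>l\<ge>N. \<forall>u\<in>S. cmod (cinner u (t k \<ominus> t l)) \<le> e * cnorm V u"
  obtains s' t' where "s' \<in> S" "t' \<in> T"
    "(\<lambda>n. cnorm V (s n \<ominus> s')) \<longlonglongrightarrow> 0" "(\<lambda>n. cnorm V (t n \<ominus> t')) \<longlonglongrightarrow> 0"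
proof -
  have sV: "s n \<in> carrier V" and tV: "t n \<in> carrier V" for n
    using csubspaceD(1)[OF S(1) s] csubspaceD(1)[OF T(1) t] by auto
  have sC: "\<exists>N. \<forall>k\<ge>N. \<forall>l\<ge>N. cnorm V (s k \<ominus> s l) < e" if e: "e > 0" for e
  proof -
    \<comment> \<open>Two contributions of \<open>e/3\<close> give the bound \<open>2*e/3\<close>;
      the remaining third restores strictness, since \<open>cnorm_leI\<close> yields only
      \<le>.\<close>
    obtain N1 where N1: "\<And>k l. k \<ge> N1 \<Longrightarrow> l \<ge> N1 \<Longrightarrow> cnorm V ((s k \<oplus> t k) \<ominus> (s l \<oplus> t l)) < e/3"
      using z[of "e/3"] e by auto
    obtain N2 where N2: "\<And>k l u. k \<ge> N2 \<Longrightarrow> l \<ge> N2 \<Longrightarrow> u \<in> S \<Longrightarrow> cmod (cinner u (t k \<ominus> t l)) \<le> e/3 * cnorm V u"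
      using C[of "e/3"] e by auto
    have "cnorm V (s k \<ominus> s l) < e" if kl: "k \<ge> max N1 N2" "l \<ge> max N1 N2" for k l
    proof -
      let ?u = "s k \<ominus> s l" and ?z = "(s k \<oplus> t k) \<ominus> (s l \<oplus> t l)" and ?t = "t k \<ominus> t l"
      have u: "?u \<in> S" "?u \<in> carrier V" using csubspace_minus S(1) s sV by auto
      have "cinner ?u ?u = cinner ?u ?z - cinner ?u ?t"
        using sV tV by (simp add: cinner_linear)
      then have "cmod (cinner ?u ?u) \<le> cmod (cinner ?u ?z) + cmod (cinner ?u ?t)"
        using norm_triangle_ineq4 by metis
      also have "\<dots> \<le> cnorm V ?u * cnorm V ?z + e/3 * cnorm V ?u"
        using Cauchy_Schwarz[of ?u ?z] N2[of k l ?u] u kl sV tV by auto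
      also have "cnorm V ?u * cnorm V ?z \<le> cnorm V ?u * (e/3)"
        using N1[of k l] kl cnorm_nonneg u by (intro mult_left_mono) auto
      finally have "cmod (cinner ?u ?u) \<le> (2*e/3) * cnorm V ?u" by (simp add: algebra_simps)
      then have "cnorm V ?u \<le> 2*e/3" using u e by (intro cnorm_leI) auto
      then show ?thesis using e by simp
    qed
    then show ?thesis by blast
  qed
  have tC: "\<exists>N. \<forall>k\<ge>N. \<forall>l\<ge>N. cnorm V (t k \<ominus> t l) < e" if e: "e > 0" for e
  proof -
    obtain N1 where N1: "\<And>k l. k \<ge> N1 \<Longrightarrow> l \<ge> N1 \<Longrightarrow> cnorm V ((s k \<oplus> t k) \<ominus> (s l \<oplus> t l)) < e/2"
      using z[of "e/2"] e by auto
    obtain N2 where N2: "\<And>k l. k \<ge> N2 \<Longrightarrow> l \<ge> N2 \<Longrightarrow> cnorm V (s k \<ominus> s l) < e/2"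
      using sC[of "e/2"] e by auto
    have "cnorm V (t k \<ominus> t l) < e" if kl: "k \<ge> max N1 N2" "l \<ge> max N1 N2" for k l
    proof -
      have "t k \<ominus> t l = ((s k \<oplus> t k) \<ominus> (s l \<oplus> t l)) \<ominus> (s k \<ominus> s l)"
        using sV tV by (intro cinner_ext) (auto simp: cinner_linear)
      then have "cnorm V (t k \<ominus> t l) \<le> cnorm V ((s k \<oplus> t k) \<ominus> (s l \<oplus> t l)) + cnorm V (s k \<ominus> s l)"
        using cnorm_minus_le sV tV by simp
      then show ?thesis using N1[of k l] N2[of k l] kl by simp
    qed
    then show ?thesis by blast
  qed
  obtain s' where s': "s' \<in> carrier V" "(\<lambda>n. cnorm V (s n \<ominus> s')) \<longlonglongrightarrow> 0"
    using Cauchy_convergent[OF sV sC] by blast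
  obtain t' where t': "t' \<in> carrier V" "(\<lambda>n. cnorm V (t n \<ominus> t')) \<longlonglongrightarrow> 0"
    using Cauchy_convergent[OF tV tC] by blast
  show ?thesis
    using that s' t' closedin_limit[OF S(2) s s'] closedin_limit[OF T(2) t t'] by blast
qed

text \<open>Assumption \<open>C\<close> expresses, without mentioning projections, that the
  orthogonal projection onto \<open>S\<close> is compact on \<open>T\<close>: the least constant
  bounding \<open>cmod (cinner u v)\<close> by a multiple of \<open>cnorm V u\<close> for all
  \<open>u\<close> in \<open>S\<close> is the norm of the projection of \<open>v\<close>.\<close>

lemma closed_sum_of_subspaces:
  assumes S: "csubspace S" "closedin (norm_topology V) S"
    and T: "csubspace T" "closedin (norm_topology V) T"
    and C: "\<And>t. (\<And>n. t n \<in> T \<and> cnorm V (t n) \<le> 1) \<Longrightarrow> \<exists>r :: nat \<Rightarrow> nat. strict_mono r \<and>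
      (\<forall>e>0. \<exists>N. \<forall>k\<ge>N. \<forall>l\<ge>N. \<forall>u\<in>S. cmod (cinner u (t (r k) \<ominus> t (r l))) \<le> e * cnorm V u)"
  shows "closedin (norm_topology V) {s \<oplus> t | s t. s \<in> S \<and> t \<in> T}"
  unfolding closedin_norm_topology_iff
proof (intro conjI allI impI)
  note SV = csubspaceD(1)[OF S(1)] and TV = csubspaceD(1)[OF T(1)]
  show "{s \<oplus> t | s t. s \<in> S \<and> t \<in> T} \<subseteq> carrier V" using SV TV by auto
  fix z l assume "(\<forall>n. z n \<in> {s \<oplus> t | s t. s \<in> S \<and> t \<in> T}) \<and> l \<in> carrier V \<and>
    (\<lambda>n. cnorm V (z n \<ominus> l)) \<longlonglongrightarrow> 0"
  then have z: "\<And>n. \<exists>s t. s \<in> S \<and> t \<in> T \<and> z n = s \<oplus> t" and l: "l \<in> carrier V"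
    and zl: "(\<lambda>n. cnorm V (z n \<ominus> l)) \<longlonglongrightarrow> 0" by auto
  have zV: "z n \<in> carrier V" for n using z[of n] SV TV by auto
  \<comment> \<open>The slack 1 avoids having to show that the infimum of the possible norms is
    attained. It is harmless, because the contradiction in the unbounded case gains half of an
    arbitrarily large norm.\<close>
  have "\<exists>s t. s \<in> S \<and> t \<in> T \<and> z n = s \<oplus> t \<and>
      (\<forall>s'\<in>S. \<forall>t'\<in>T. z n = s' \<oplus> t' \<longrightarrow> cnorm V t \<le> cnorm V t' + 1)" for n
  proof -
    let ?X = "{cnorm V t | s t. s \<in> S \<and> t \<in> T \<and> z n = s \<oplus> t}"
    have "?X \<noteq> {}" using z[of n] by auto
    moreover have "bdd_below ?X" using TV cnorm_nonneg by (intro bdd_belowI[of _ 0]) auto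
    moreover obtain x where x: "x \<in> ?X" "x < Inf ?X + 1"
      using cInf_lessD[OF \<open>?X \<noteq> {}\<close>, of "Inf ?X + 1"] by auto
    ultimately have *: "x \<le> y + 1" if "y \<in> ?X" for y
      using cInf_lower[OF that] by simp
    from x(1) obtain s t where st: "s \<in> S" "t \<in> T" "z n = s \<oplus> t" "x = cnorm V t" by auto
    show ?thesis
    proof (intro exI conjI ballI impI)
      fix s' t' assume "s' \<in> S" "t' \<in> T" "z n = s' \<oplus> t'"
      then show "cnorm V t \<le> cnorm V t' + 1" unfolding st(4)[symmetric] by (intro *) auto
    qed (use st in auto)
  qed
  then obtain s t where s: "\<And>n. s n \<in> S" and t: "\<And>n. t n \<in> T" and zst: "\<And>n. z n = s n \<oplus> t n"
    and min: "\<And>n s' t'. s' \<in> S \<Longrightarrow> t' \<in> T \<Longrightarrow> z n = s' \<oplus> t' \<Longrightarrow> cnorm V (t n) \<le> cnorm V t' + 1"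
    by metis
  note sV = SV[OF s] and tV = TV[OF t]
  show "l \<in> {s \<oplus> t | s t. s \<in> S \<and> t \<in> T}"
  proof (cases "\<exists>B. \<forall>n. cnorm V (t n) \<le> B")
    case True
    then obtain B0 where B0: "\<And>n. cnorm V (t n) \<le> B0" by blast
    \<comment> \<open>A positive bound is needed to scale the sequence into the unit ball, where
      \<open>C\<close> applies; \<open>C'\<close> undoes the scaling by asking for
      \<open>e / B\<close>.\<close>
    define B where "B = max B0 1"
    have B: "B > 0" "\<And>n. cnorm V (t n) \<le> B" using B0 by (auto simp: B_def intro: max.coboundedI1)
    have "of_real (1/B) \<odot> t n \<in> T \<and> cnorm V (of_real (1/B) \<odot> t n) \<le> 1" for n
      using T t tV B by (simp add: csubspaceD cnorm_smult norm_divide)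
    then obtain r :: "nat \<Rightarrow> nat" where r: "strict_mono r" and
      rC: "\<And>e. e > 0 \<Longrightarrow> \<exists>N. \<forall>k\<ge>N. \<forall>l\<ge>N. \<forall>u\<in>S. cmod (cinner u (of_real (1/B) \<odot> t (r k) \<ominus> of_real (1/B) \<odot> t (r l))) \<le> e * cnorm V u"
      using C[of "\<lambda>n. of_real (1/B) \<odot> t n"] by blast
    have C': "\<exists>N. \<forall>k\<ge>N. \<forall>l\<ge>N. \<forall>u\<in>S. cmod (cinner u (t (r k) \<ominus> t (r l))) \<le> e * cnorm V u"
      if e: "e > 0" for e
    proof -
      obtain N where N: "\<And>k l u. k\<ge>N \<Longrightarrow> l\<ge>N \<Longrightarrow> u\<in>S \<Longrightarrow>
          cmod (cinner u (of_real (1/B) \<odot> t (r k) \<ominus> of_real (1/B) \<odot> t (r l))) \<le> e / B * cnorm V u"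
        using rC[OF divide_pos_pos[OF e B(1)]] by blast
      have "cmod (cinner u (t (r k) \<ominus> t (r l))) \<le> e * cnorm V u"
        if "k \<ge> N" "l \<ge> N" "u \<in> S" for k l u
      proof -
        have "cinner u (of_real (1/B) \<odot> t (r k) \<ominus> of_real (1/B) \<odot> t (r l)) =
            of_real (1/B) * cinner u (t (r k) \<ominus> t (r l))"
          using that SV[of u] tV by (simp add: cinner_linear algebra_simps)
        from N[OF that, unfolded this] show ?thesis
          using B(1) by (simp add: norm_mult norm_divide divide_le_cancel)
      qed
      then show ?thesis by blast
    qed
    have zr: "(\<lambda>n. cnorm V (z (r n) \<ominus> l)) \<longlonglongrightarrow> 0"
      using LIMSEQ_subseq_LIMSEQ[OF zl r] by (simp add: o_def)
    have z': "\<exists>N. \<forall>k\<ge>N. \<forall>j\<ge>N. cnorm V ((s (r k) \<oplus> t (r k)) \<ominus> (s (r j) \<oplus> t (r j))) < e"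
      if "e > 0" for e
      using convergent_Cauchy[OF zV l zr that] by (simp add: zst)
    obtain s' t' where st': "s' \<in> S" "t' \<in> T"
      and sl: "(\<lambda>n. cnorm V (s (r n) \<ominus> s')) \<longlonglongrightarrow> 0" and tl: "(\<lambda>n. cnorm V (t (r n) \<ominus> t')) \<longlonglongrightarrow> 0"
      using sum_components_converge[OF S T, of "\<lambda>n. s (r n)" "\<lambda>n. t (r n)"] s t z' C' by blast
    have "(\<lambda>n. cnorm V (z (r n) \<ominus> (s' \<oplus> t'))) \<longlonglongrightarrow> 0"
    proof (rule tendsto_sandwich[OF _ _ tendsto_const])
      show "(\<lambda>n. cnorm V (s (r n) \<ominus> s') + cnorm V (t (r n) \<ominus> t')) \<longlonglongrightarrow> 0"
        using tendsto_add[OF sl tl] by simp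
    qed (use st' SV TV sV tV zV cnorm_add_minus_add cnorm_nonneg in \<open>auto simp: zst\<close>)
    then have "l = s' \<oplus> t'" using zr zV l SV TV st' by (intro cnorm_limit_unique[of "\<lambda>n. z (r n)"]) auto
    then show ?thesis using st' by auto
  next
    case False
    \<comment> \<open>The growth in \<open>k\<close> makes the normalized sums vanish like
      \<open>M / real (Suc k)\<close>; the offset 4 makes the final inequality
      \<open>c \<le> c * (1/2) + 1\<close> impossible.\<close>
    then have "\<exists>n. cnorm V (t n) > real k + 4" for k by (meson not_le)
    then obtain q where q: "\<And>k. cnorm V (t (q k)) > real k + 4" by metis
    define a where "a k = cnorm V (t (q k))" for k
    have a: "a k > real k + 4" for k using q by (simp add: a_def)
    have a0: "a k > 0" for k using a[of k] by linarith
    obtain M where M: "M > 0" "\<And>n. cnorm V (z n) \<le> M"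
    proof -
      obtain K where K: "\<And>n. norm (cnorm V (z n \<ominus> l)) \<le> K"
        using convergent_imp_Bseq[OF convergentI[OF zl]] unfolding Bseq_def by blast
      have "cnorm V (z n) \<le> \<bar>K\<bar> + cnorm V l + 1" for n
        using cnorm_minus_triangle[of "z n" l \<zero>] K[of n] zV l by simp
      then show ?thesis using that[of "\<bar>K\<bar> + cnorm V l + 1"] cnorm_nonneg[OF l] by fastforce
    qed
    define s1 where "s1 k = of_real (1 / a k) \<odot> s (q k)" for k
    define t1 where "t1 k = of_real (1 / a k) \<odot> t (q k)" for k
    have s1: "s1 k \<in> S" and t1: "t1 k \<in> T" for k
      using s t S T by (auto simp: s1_def t1_def csubspaceD)
    note s1V = SV[OF s1] and t1V = TV[OF t1]
    have "cnorm V (t1 k) \<le> 1" for k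
      using a0[of k] tV by (simp add: t1_def cnorm_smult norm_divide a_def)
    then obtain r :: "nat \<Rightarrow> nat" where r: "strict_mono r" and
      rC: "\<And>e. e > 0 \<Longrightarrow> \<exists>N. \<forall>k\<ge>N. \<forall>l\<ge>N. \<forall>u\<in>S. cmod (cinner u (t1 (r k) \<ominus> t1 (r l))) \<le> e * cnorm V u"
      using C[of t1] t1 by auto
    have "cnorm V (s1 k \<oplus> t1 k) \<le> M / real (Suc k)" for k
    proof -
      have "s1 k \<oplus> t1 k = of_real (1 / a k) \<odot> z (q k)"
        using sV tV by (intro cinner_ext) (auto simp: zst s1_def t1_def cinner_linear algebra_simps)
      then have "cnorm V (s1 k \<oplus> t1 k) = cnorm V (z (q k)) / a k"
        using zV a0[of k] by (simp add: cnorm_smult norm_divide)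
      also have "\<dots> \<le> M / real (Suc k)"
        using M a[of k] by (intro frac_le) auto
      finally show ?thesis .
    qed
    moreover have Ml: "(\<lambda>k. M / real (Suc k)) \<longlonglongrightarrow> 0"
      using tendsto_mult[OF tendsto_const[of M] LIMSEQ_inverse_real_of_nat] by (simp add: divide_inverse)
    ultimately have "(\<lambda>k. cnorm V (s1 k \<oplus> t1 k)) \<longlonglongrightarrow> 0"
      using s1V t1V cnorm_nonneg by (intro tendsto_sandwich[OF _ _ tendsto_const Ml]) auto
    from LIMSEQ_subseq_LIMSEQ[OF this r]
    have z1: "(\<lambda>k. cnorm V (s1 (r k) \<oplus> t1 (r k))) \<longlonglongrightarrow> 0" by (simp add: o_def)
    have z1': "\<exists>N. \<forall>k\<ge>N. \<forall>j\<ge>N. cnorm V ((s1 (r k) \<oplus> t1 (r k)) \<ominus> (s1 (r j) \<oplus> t1 (r j))) < e"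
      if "e > 0" for e
      using convergent_Cauchy[of "\<lambda>k. s1 (r k) \<oplus> t1 (r k)" \<zero> e] z1 s1V t1V that by simp
    obtain s' t' where st': "s' \<in> S" "t' \<in> T"
      and sl: "(\<lambda>n. cnorm V (s1 (r n) \<ominus> s')) \<longlonglongrightarrow> 0" and tl: "(\<lambda>n. cnorm V (t1 (r n) \<ominus> t')) \<longlonglongrightarrow> 0"
      using sum_components_converge[OF S T, of "\<lambda>n. s1 (r n)" "\<lambda>n. t1 (r n)"] s1 t1 z1' rC by blast
    note s'V = SV[OF st'(1)] and t'V = TV[OF st'(2)]
    have "(\<lambda>n. cnorm V ((s1 (r n) \<oplus> t1 (r n)) \<ominus> (s' \<oplus> t'))) \<longlonglongrightarrow> 0"
    proof (rule tendsto_sandwich[OF _ _ tendsto_const])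
      show "(\<lambda>n. cnorm V (s1 (r n) \<ominus> s') + cnorm V (t1 (r n) \<ominus> t')) \<longlonglongrightarrow> 0"
        using tendsto_add[OF sl tl] by simp
    qed (use s'V t'V s1V t1V cnorm_add_minus_add cnorm_nonneg in auto)
    then have "s' \<oplus> t' = \<zero>"
      using z1 s'V t'V s1V t1V
      by (intro cnorm_limit_unique[of "\<lambda>n. s1 (r n) \<oplus> t1 (r n)"]) auto
    \<comment> \<open>The normalized sums tend to zero, so the limits of the components cancel; this
      is what places \<open>t'\<close> in both subspaces.\<close>
    then have "t' = (- 1) \<odot> s'"
      using s'V t'V by (metis M.minus_unique M.minus_equality M.a_comm minus_eq_smult)
    then have t'S: "t' \<in> S" using S st' csubspaceD by auto
    \<comment> \<open>With \<open>c\<close> the norm of \<open>t n\<close>, closeness 1/2 means that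
      subtracting \<open>of_real c \<odot> t'\<close> from \<open>t n\<close> leaves a vector of
      norm at most \<open>c/2\<close>. Adding the same vector to \<open>s n\<close> keeps the sum,
      so almost minimality gives \<open>c \<le> c/2 + 1\<close>.\<close>
    obtain k where k: "cnorm V (t1 (r k) \<ominus> t') < 1/2"
      using tl cnorm_nonneg t1V t'V by (fastforce simp: LIMSEQ_iff dest: spec[of _ "1/2"])
    define n c where "n = q (r k)" and "c = a (r k)"
    have c: "c > 4" using a[of "r k"] by (simp add: c_def)
    have ct: "of_real c \<odot> t' \<in> S" "of_real c \<odot> t' \<in> T" using t'S st' S T csubspaceD by auto
    have eq: "z n = (s n \<oplus> of_real c \<odot> t') \<oplus> (t n \<ominus> of_real c \<odot> t')"
      using sV tV t'V by (intro cinner_ext) (auto simp: zst cinner_linear)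
    have "t n \<ominus> of_real c \<odot> t' = of_real c \<odot> (t1 (r k) \<ominus> t')"
      using sV tV t'V c
      by (intro cinner_ext) (auto simp: t1_def n_def cinner_linear algebra_simps simp flip: c_def)
    then have "cnorm V (t n \<ominus> of_real c \<odot> t') \<le> c * (1/2)"
      using k c t1V t'V by (simp add: cnorm_smult)
    moreover have "cnorm V (t n) \<le> cnorm V (t n \<ominus> of_real c \<odot> t') + 1"
      using ct s t S T by (intro min[OF _ _ eq]) (auto simp: csubspaceD csubspace_minus)
    ultimately have "c \<le> c * (1/2) + 1" by (simp add: c_def a_def n_def)
    then show ?thesis using c by simp
  qed
qed

end

section \<open>Adjoints and compact operators\<close>

context complex_hilbert_space
begin

text \<open>The representing vector is the minimizer of \<open>\<parallel>x\<parallel>\<^sup>2 - 2 Re (f x)\<close>.\<close>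

lemma Riesz_representation:
  assumes add: "\<And>x y. x \<in> carrier V \<Longrightarrow> y \<in> carrier V \<Longrightarrow> f (x \<oplus> y) = f x + f y"
    and smult: "\<And>c x. x \<in> carrier V \<Longrightarrow> f (c \<odot> x) = c * f x"
    and bound: "\<And>x. x \<in> carrier V \<Longrightarrow> cmod (f x) \<le> C * cnorm V x"
  obtains x where "x \<in> carrier V" "\<And>z. z \<in> carrier V \<Longrightarrow> cinner z x = f z"
proof -
  define J where "J x = (cnorm V x)\<^sup>2 - 2 * Re (f x)" for x
  define d where "d = Inf (J ` carrier V)"
  \<comment> \<open>Completing the square: \<open>- 2 * C * cnorm V x\<close> is at least
    \<open>- C\<^sup>2\<close> minus the square of the norm.\<close>
  have J_ge: "J x \<ge> - C\<^sup>2" if "x \<in> carrier V" for x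
  proof -
    have "Re (f x) \<le> C * cnorm V x"
      using bound[OF that] complex_Re_le_cmod[of "f x"] by simp
    moreover have "0 \<le> (cnorm V x - C)\<^sup>2" by simp
    ultimately show ?thesis by (simp add: J_def power2_diff mult.commute[of C])
  qed
  then have d: "d \<le> J x" if "x \<in> carrier V" for x
    unfolding d_def using that by (intro cInf_lower bdd_belowI[of _ "- C\<^sup>2"]) auto
  have expand: "J (x \<oplus> of_real t \<odot> z) = J x + 2 * t * Re (cinner z x - f z) + t\<^sup>2 * (cnorm V z)\<^sup>2"
    if xz: "x \<in> carrier V" "z \<in> carrier V" for x z t
  proof -
    have sq: "(cnorm V v)\<^sup>2 = Re (cinner v v)" if "v \<in> carrier V" for v
      using cinner_self[OF that] by simp
    have "Re (cinner x z) = Re (cinner z x)" using cinner_commute[of z x] xz by simp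
    then have "(cnorm V (x \<oplus> of_real t \<odot> z))\<^sup>2 =
        (cnorm V x)\<^sup>2 + 2 * t * Re (cinner z x) + t\<^sup>2 * (cnorm V z)\<^sup>2"
      using xz by (simp add: sq cinner_linear) (simp add: algebra_simps power2_eq_square)
    then show ?thesis using xz by (simp add: J_def add smult smult_in_carrier algebra_simps)
  qed
  \<comment> \<open>The error made by \<open>x\<close> as a representing vector. By
    \<open>expand\<close>, \<open>2 * Re (g x z)\<close> is the derivative of \<open>J\<close> at
    \<open>x\<close> in direction \<open>z\<close>, so near-minimizers should have small
    \<open>g\<close>.\<close>
  define g where "g x z = cinner z x - f z" for x z
  have approx: "cmod (g x z) \<le> 2 * e * cnorm V z"
    if x: "x \<in> carrier V" "J x \<le> d + e\<^sup>2" and e: "e > 0" and z: "z \<in> carrier V" for x z e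
  proof -
    have Re: "\<bar>Re (g x z)\<bar> \<le> e * cnorm V z" if z: "z \<in> carrier V" for z
    proof (cases "cnorm V z = 0")
      case True
      then have "z = \<zero>" using z cnorm_eq_zero_iff by blast
      moreover have "f \<zero> = 0" using bound[of \<zero>] by simp
      ultimately show ?thesis using x(1) True by (simp add: g_def)
    next
      case False
      define N where "N = (cnorm V z)\<^sup>2"
      have N: "N > 0" using False by (simp add: N_def)
      \<comment> \<open>The minimizer of the quadratic in \<open>t\<close> from
        \<open>expand\<close>. Moving there lowers \<open>J\<close> by
        \<open>(Re (g x z))\<^sup>2 / N\<close>, which cannot exceed the distance
        \<open>e\<^sup>2\<close> of \<open>J x\<close> from the infimum.\<close>
      define t where "t = - Re (g x z) / N"
      have "d \<le> J (x \<oplus> of_real t \<odot> z)" using x z by (intro d) (simp add: smult_in_carrier)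
      then have "0 \<le> e\<^sup>2 + 2 * t * Re (g x z) + t\<^sup>2 * N"
        using x(2) unfolding expand[OF x(1) z] g_def N_def by linarith
      moreover have "2 * t * Re (g x z) + t\<^sup>2 * N = - (Re (g x z))\<^sup>2 / N"
        using N by (simp add: t_def field_simps power2_eq_square)
      ultimately have "(Re (g x z))\<^sup>2 / N \<le> e\<^sup>2" by simp
      then have "(Re (g x z))\<^sup>2 \<le> (e * cnorm V z)\<^sup>2"
        using N by (simp add: field_simps power_mult_distrib flip: N_def)
      then show ?thesis using e cnorm_nonneg[OF z] by (simp add: abs_le_square_iff[symmetric])
    qed
    \<comment> \<open>Real steps \<open>t\<close> control only the real part; the direction \<i>
      \<open>\<odot> z\<close> supplies the imaginary part. Adding the two bounds produces the
      factor 2.\<close>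
    have "g x (\<i> \<odot> z) = \<i> * g x z" using x z by (simp add: g_def cinner_linear smult algebra_simps)
    then have "\<bar>Im (g x z)\<bar> \<le> e * cnorm V z"
      using Re[of "\<i> \<odot> z"] z by (simp add: smult_in_carrier cnorm_smult)
    then show ?thesis using Re[OF z] cmod_le[of "g x z"] by linarith
  qed
  define e where "e n = 1 / real (Suc n)" for n
  have e: "e n > 0" for n by (simp add: e_def)
  have el: "e \<longlonglongrightarrow> 0" using LIMSEQ_inverse_real_of_nat by (simp add: e_def[abs_def] divide_inverse)
  have "\<exists>x. x \<in> carrier V \<and> J x \<le> d + (e n)\<^sup>2" for n
  proof -
    have "J ` carrier V \<noteq> {}" using M.zero_closed by blast
    then obtain y where "y \<in> J ` carrier V" "y < d + (e n)\<^sup>2"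
      using cInf_lessD[of "J ` carrier V" "d + (e n)\<^sup>2"] e[of n] by (auto simp: d_def)
    then show ?thesis by force
  qed
  then obtain x where x: "\<And>n. x n \<in> carrier V" "\<And>n. J (x n) \<le> d + (e n)\<^sup>2" by metis
  have gx: "cmod (g (x n) z) \<le> 2 * e n * cnorm V z" if "z \<in> carrier V" for n z
    using approx[OF x e that] .
  \<comment> \<open>The functional \<open>f\<close> cancels in the difference of two errors, so
    pairing \<open>x n \<ominus> x m\<close> with itself is controlled by \<open>gx\<close>: the
    minimizing sequence is Cauchy.\<close>
  have diff: "cnorm V (x n \<ominus> x m) \<le> 2 * e n + 2 * e m" for n m
  proof (rule cnorm_leI)
    let ?z = "x n \<ominus> x m"
    have "cinner ?z ?z = g (x n) ?z - g (x m) ?z" using x by (simp add: g_def cinner_linear)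
    then have "cmod (cinner ?z ?z) \<le> cmod (g (x n) ?z) + cmod (g (x m) ?z)"
      using norm_triangle_ineq4 by metis
    then show "cmod (cinner ?z ?z) \<le> (2 * e n + 2 * e m) * cnorm V ?z"
      using gx[of ?z n] gx[of ?z m] x by (simp add: algebra_simps)
  qed (use x e[of n] e[of m] in auto)
  have "\<exists>N. \<forall>k\<ge>N. \<forall>l\<ge>N. cnorm V (x k \<ominus> x l) < c" if c: "c > 0" for c
  proof -
    obtain N where N: "\<And>n. n \<ge> N \<Longrightarrow> e n < c / 4"
      using el c e by (fastforce simp: LIMSEQ_iff dest: spec[of _ "c/4"])
    have "cnorm V (x k \<ominus> x l) < c" if "k \<ge> N" "l \<ge> N" for k l
      using diff[of k l] N[OF that(1)] N[OF that(2)] by linarith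
    then show ?thesis by blast
  qed
  then obtain y where y: "y \<in> carrier V" "(\<lambda>n. cnorm V (x n \<ominus> y)) \<longlonglongrightarrow> 0"
    using Cauchy_convergent[of x] x by blast
  show ?thesis
  proof (rule that[OF y(1)])
    fix z assume z: "z \<in> carrier V"
    have "cmod (g y z) \<le> cnorm V z * (cnorm V (x n \<ominus> y) + 2 * e n)" for n
    proof -
      have "g y z = g (x n) z - cinner z (x n \<ominus> y)" using x y z by (simp add: g_def cinner_linear)
      then have "cmod (g y z) \<le> cmod (g (x n) z) + cmod (cinner z (x n \<ominus> y))"
        using norm_triangle_ineq4 by metis
      then show ?thesis
        using gx[OF z, of n] Cauchy_Schwarz[of z "x n \<ominus> y"] x y z by (simp add: algebra_simps)
    qed
    moreover have "(\<lambda>n. cnorm V z * (cnorm V (x n \<ominus> y) + 2 * e n)) \<longlonglongrightarrow> cnorm V z * (0 + 2 * 0)"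
      by (intro tendsto_intros y el)
    ultimately have "cmod (g y z) \<le> 0" by (intro LIMSEQ_le_const) auto
    then show "cinner z y = f z" by (simp add: g_def)
  qed
qed

end

section \<open>Bounded operators, their adjoints and compactness by subsequences\<close>

lemma bounded_operatorD:
  assumes "bounded_operator V W T"
  shows "x \<in> carrier V \<Longrightarrow> T x \<in> carrier W"
    and "x \<in> carrier V \<Longrightarrow> y \<in> carrier V \<Longrightarrow> T (x \<oplus>\<^bsub>V\<^esub> y) = T x \<oplus>\<^bsub>W\<^esub> T y"
    and "x \<in> carrier V \<Longrightarrow> T (c \<odot>\<^bsub>V\<^esub> x) = c \<odot>\<^bsub>W\<^esub> T x"
  using assms by (auto simp: bounded_operator_def)

text \<open>The definition leaves the sign of the constant open, and on the zero space it may be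
  negative; the absolute value repairs this for use in monotonicity arguments.\<close>

lemma bounded_operator_bound:
  assumes "bounded_operator V W T" "complex_inner_space V"
  obtains C where "C \<ge> 0" "\<And>x. x \<in> carrier V \<Longrightarrow> cnorm W (T x) \<le> C * cnorm V x"
proof -
  interpret V: complex_inner_space V by fact
  obtain C where C: "\<forall>x\<in>carrier V. cnorm W (T x) \<le> C * cnorm V x"
    using assms by (auto simp: bounded_operator_def)
  show ?thesis
  proof (rule that[of "\<bar>C\<bar>"])
    fix x assume x: "x \<in> carrier V"
    have "C * cnorm V x \<le> \<bar>C\<bar> * cnorm V x" using V.cnorm_nonneg[OF x] by (intro mult_right_mono) auto
    then show "cnorm W (T x) \<le> \<bar>C\<bar> * cnorm V x" using C x by fastforce
  qed simp
qed

lemma bounded_operator_minus: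
  assumes "bounded_operator V W T" "complex_inner_space V" "complex_inner_space W"
    "x \<in> carrier V" "y \<in> carrier V"
  shows "T (x \<ominus>\<^bsub>V\<^esub> y) = T x \<ominus>\<^bsub>W\<^esub> T y"
proof -
  interpret V: complex_inner_space V by fact
  interpret W: complex_inner_space W by fact
  show ?thesis using assms bounded_operatorD[OF assms(1)]
    by (simp add: a_minus_def V.minus_eq_smult W.minus_eq_smult V.smult_in_carrier)
qed

text \<open>Riesz representation applied to \<open>cinner (T z) y\<close> as a functional of
  \<open>z\<close> gives existence, and \<open>cinner_ext\<close> gives uniqueness; together they
  make the definite description in the definition meaningful.\<close>

lemma hilbert_adjoint:
  assumes "complex_hilbert_space V" "complex_inner_space W" "bounded_operator V W T"
    "y \<in> carrier W"
  shows "hilbert_adjoint V W T y \<in> carrier V"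
    and "z \<in> carrier V \<Longrightarrow> cinner\<^bsub>V\<^esub> z (hilbert_adjoint V W T y) = cinner\<^bsub>W\<^esub> (T z) y"
proof -
  interpret V: complex_hilbert_space V by fact
  interpret W: complex_inner_space W by fact
  note T = bounded_operatorD[OF assms(3)]
  obtain C where C: "C \<ge> 0" "\<And>x. x \<in> carrier V \<Longrightarrow> cnorm W (T x) \<le> C * cnorm V x"
    using bounded_operator_bound[OF assms(3) V.complex_inner_space_axioms] by blast
  have "cmod (cinner\<^bsub>W\<^esub> (T z) y) \<le> (C * cnorm W y) * cnorm V z" if z: "z \<in> carrier V" for z
  proof -
    have "cmod (cinner\<^bsub>W\<^esub> (T z) y) \<le> cnorm W (T z) * cnorm W y"
      using W.Cauchy_Schwarz T z assms(4) by blast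
    also have "\<dots> \<le> (C * cnorm V z) * cnorm W y"
      using C z W.cnorm_nonneg[OF assms(4)] by (intro mult_right_mono) auto
    finally show ?thesis by (simp add: mult_ac)
  qed
  then obtain x where x: "x \<in> carrier V" "\<And>z. z \<in> carrier V \<Longrightarrow> cinner\<^bsub>V\<^esub> z x = cinner\<^bsub>W\<^esub> (T z) y"
    using V.Riesz_representation[of "\<lambda>z. cinner\<^bsub>W\<^esub> (T z) y" "C * cnorm W y"] T assms(4)
    by (auto simp: W.cinner_linear)
  have "\<exists>!x. x \<in> carrier V \<and> (\<forall>z\<in>carrier V. cinner\<^bsub>V\<^esub> z x = cinner\<^bsub>W\<^esub> (T z) y)"
  proof (rule ex1I[of _ x])
    fix x' assume x': "x' \<in> carrier V \<and> (\<forall>z\<in>carrier V. cinner\<^bsub>V\<^esub> z x' = cinner\<^bsub>W\<^esub> (T z) y)"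
    show "x' = x"
    proof (rule V.cinner_ext)
      fix z assume "z \<in> carrier V"
      then show "cinner\<^bsub>V\<^esub> x' z = cinner\<^bsub>V\<^esub> x z"
        using x x' V.cinner_commute[of z x] V.cinner_commute[of z x'] by simp
    qed (use x x' in auto)
  qed (use x in auto)
  from theI'[OF this] show "hilbert_adjoint V W T y \<in> carrier V"
    "z \<in> carrier V \<Longrightarrow> cinner\<^bsub>V\<^esub> z (hilbert_adjoint V W T y) = cinner\<^bsub>W\<^esub> (T z) y"
    by (auto simp: hilbert_adjoint_def)
qed

text \<open>Compactness is defined on the unit ball, so the sequence is divided by a positive bound
  \<open>b\<close>; by linearity, the limit found there only has to be multiplied by
  \<open>b\<close> again.\<close>

lemma compact_operator_subseq:
  fixes x :: "nat \<Rightarrow> 'a"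
  assumes "complex_inner_space V" "complex_inner_space W" "compact_operator V W T"
    and x: "\<And>n. x n \<in> carrier V" "\<And>n. cnorm V (x n) \<le> B"
  obtains r l where "strict_mono r" "l \<in> carrier W"
    "(\<lambda>n. cnorm W (T (x (r n)) \<ominus>\<^bsub>W\<^esub> l)) \<longlonglongrightarrow> 0"
proof -
  interpret V: complex_inner_space V by fact
  interpret W: complex_inner_space W by fact
  have bT: "bounded_operator V W T" using assms(3) by (simp add: compact_operator_def)
  note T = bounded_operatorD[OF bT]
  define b where "b = max B 1"
  have b: "b > 0" "cnorm V (x n) \<le> b" for n using x(2) by (auto simp: b_def intro: max.coboundedI1)
  let ?D = "{x \<in> carrier V. cnorm V x \<le> 1}"
  define y where "y n = of_real (1 / b) \<odot>\<^bsub>V\<^esub> x n" for n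
  have y: "y n \<in> ?D" for n
    using x b by (simp add: y_def V.smult_in_carrier V.cnorm_smult norm_divide)
  have "T ` ?D \<subseteq> norm_topology W closure_of (T ` ?D)"
    using T(1) by (intro closure_of_subset) (auto simp: norm_topology_def)
  then have "range (\<lambda>n. T (y n)) \<subseteq> norm_topology W closure_of (T ` ?D)" using y by blast
  moreover have "compactin (W.metric.mtopology) (norm_topology W closure_of (T ` ?D))"
    using assms(3) by (simp add: compact_operator_def norm_topology_def)
  ultimately obtain l r where r: "strict_mono r"
    and "limitin W.metric.mtopology ((\<lambda>n. T (y n)) \<circ> r) l sequentially"
    unfolding W.metric.compactin_sequentially by meson
  then have l: "l \<in> carrier W" "(\<lambda>n. cnorm W (T (y (r n)) \<ominus>\<^bsub>W\<^esub> l)) \<longlonglongrightarrow> 0"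
    using W.limitin_norm_topology_iff[of "\<lambda>n. T (y (r n))" l] y T(1)
    by (auto simp: norm_topology_def o_def)
  have "cnorm W (T (x (r n)) \<ominus>\<^bsub>W\<^esub> of_real b \<odot>\<^bsub>W\<^esub> l) = b * cnorm W (T (y (r n)) \<ominus>\<^bsub>W\<^esub> l)" for n
  proof -
    have "T (x (r n)) \<ominus>\<^bsub>W\<^esub> of_real b \<odot>\<^bsub>W\<^esub> l = of_real b \<odot>\<^bsub>W\<^esub> (T (y (r n)) \<ominus>\<^bsub>W\<^esub> l)"
      using x T l b by (intro W.cinner_ext) (auto simp: y_def W.cinner_linear V.smult_in_carrier algebra_simps)
    then show ?thesis using b T y l by (simp add: W.cnorm_smult)
  qed
  then show ?thesis
    using r l tendsto_mult[OF tendsto_const[of b] l(2)]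
    by (intro that[of r "of_real b \<odot>\<^bsub>W\<^esub> l"]) (auto simp: W.smult_in_carrier)
qed

text \<open>Successive thinning, one element of \<open>P\<close> at a time. Assumption
  \<open>step\<close> starts from an arbitrary \<open>f\<close> because it thins a sequence already
  thinned for the other elements, and \<open>sub\<close> preserves what those have achieved.\<close>

lemma common_subseq:
  fixes Q :: "'e \<Rightarrow> (nat \<Rightarrow> nat) \<Rightarrow> bool"
  assumes "finite P"
    and step: "\<And>e (f :: nat \<Rightarrow> nat). e \<in> P \<Longrightarrow> strict_mono f \<Longrightarrow> \<exists>r. strict_mono r \<and> Q e (f \<circ> r)"
    and sub: "\<And>e f r. e \<in> P \<Longrightarrow> Q e f \<Longrightarrow> strict_mono r \<Longrightarrow> Q e (f \<circ> r)"
  shows "\<exists>r. strict_mono r \<and> (\<forall>e\<in>P. Q e r)"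
  using assms
proof (induction P)
  case empty
  show ?case using strict_mono_id by blast
next
  case (insert e P)
  then obtain f where f: "strict_mono f" "\<forall>e\<in>P. Q e f" by blast
  obtain r where r: "strict_mono r" "Q e (f \<circ> r)"
    using insert.prems(1)[of e f] f(1) by blast
  have "Q d (f \<circ> r)" if "d \<in> insert e P" for d
    using that r f(2) insert.prems(2)[of d f r] by (cases "d = e") blast+
  then show ?case using strict_mono_o[OF f(1) r(1)] by blast
qed

section \<open>Bounded preimages for finite families of operators\<close>

context complex_inner_space
begin

lemma finsum_in_carrier: "(\<And>i. i \<in> A \<Longrightarrow> f i \<in> carrier V) \<Longrightarrow> finsum V f A \<in> carrier V"
  by (rule M.finsum_closed) auto

lemma cinner_finsum_left:
  assumes "finite A" "\<And>i. i \<in> A \<Longrightarrow> f i \<in> carrier V" "z \<in> carrier V"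
  shows "cinner (finsum V f A) z = (\<Sum>i\<in>A. cinner (f i) z)"
  using assms
proof (induction A)
  case (insert a A)
  then have "finsum V f (insert a A) = f a \<oplus> finsum V f A"
    by (intro M.finsum_insert) auto
  then show ?case using insert by (simp add: cinner_add_left finsum_in_carrier)
qed (simp add: M.finsum_empty)

lemma cnorm_finsum_le:
  assumes "finite A" "\<And>i. i \<in> A \<Longrightarrow> f i \<in> carrier V"
  shows "cnorm V (finsum V f A) \<le> (\<Sum>i\<in>A. cnorm V (f i))"
  using assms
proof (induction A)
  case (insert a A)
  then have "finsum V f (insert a A) = f a \<oplus> finsum V f A"
    by (intro M.finsum_insert) auto
  then show ?case
    using insert cnorm_triangle[of "f a" "finsum V f A"] by (force simp: finsum_in_carrier)
qed (simp add: M.finsum_empty)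

end

text \<open>The steps are dominated by a geometric series with sum \<open>2 * c\<close>, so
  completeness gives a limit within that distance of the start. This turns successive approximations
  of a preimage into an exact one.\<close>

lemma (in complex_hilbert_space) geometric_convergent:
  assumes f: "\<And>n. f n \<in> carrier V" and step: "\<And>n. cnorm V (f (Suc n) \<ominus> f n) \<le> c / 2 ^ n"
  obtains x where "x \<in> carrier V" "(\<lambda>n. cnorm V (f n \<ominus> x)) \<longlonglongrightarrow> 0"
    "cnorm V (x \<ominus> f 0) \<le> 2 * c"
proof -
  have c: "c \<ge> 0" using step[of 0] cnorm_nonneg[of "f 1 \<ominus> f 0"] f by simp
  \<comment> \<open>Keeping the subtracted term \<open>1 / 2 ^ m\<close> makes the bound additive in
    \<open>m\<close>, as the induction requires.\<close>
  have dist: "cnorm V (f m \<ominus> f k) \<le> 2 * c * (1 / 2 ^ k - 1 / 2 ^ m)" if "k \<le> m" for k m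
    using that
  proof (induction m rule: dec_induct)
    case base
    have "f k \<ominus> f k = \<zero>" using f by (simp add: minus_eq_zero_iff)
    then show ?case by simp
  next
    case (step m)
    have "cnorm V (f (Suc m) \<ominus> f k) \<le> cnorm V (f (Suc m) \<ominus> f m) + cnorm V (f m \<ominus> f k)"
      using f by (intro cnorm_minus_triangle)
    moreover have "2 * c * (1 / 2 ^ k - 1 / 2 ^ m) + c / 2 ^ m = 2 * c * (1 / 2 ^ k - 1 / 2 ^ Suc m)"
      by (simp add: field_simps)
    ultimately show ?case using step.IH assms(2)[of m] by linarith
  qed
  have dist': "cnorm V (f m \<ominus> f k) \<le> 2 * c * (1 / 2) ^ k" if "k \<le> m" for k m
  proof -
    have "2 * c * (1 / 2 ^ k - 1 / 2 ^ m) \<le> 2 * c * (1 / 2) ^ k"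
      using c by (intro mult_left_mono) (auto simp: power_one_over)
    then show ?thesis using dist[OF that] by simp
  qed
  have lim: "(\<lambda>n. 2 * c * (1 / 2) ^ n) \<longlonglongrightarrow> 0"
    by (intro tendsto_mult_right_zero LIMSEQ_power_zero) simp
  have "\<exists>N. \<forall>k\<ge>N. \<forall>l\<ge>N. cnorm V (f k \<ominus> f l) < e" if e: "e > 0" for e
  proof -
    obtain N where N: "\<And>n. n \<ge> N \<Longrightarrow> 2 * c * (1 / 2) ^ n < e"
      using order_tendstoD(2)[OF lim e] by (auto simp: eventually_sequentially)
    have "cnorm V (f k \<ominus> f l) < e" if "k \<ge> N" "l \<ge> N" for k l
      using dist'[of k l] dist'[of l k] N[of k] N[of l] that f cnorm_minus_commute[of "f k" "f l"]
      by (cases "k \<le> l") auto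
    then show ?thesis by blast
  qed
  then obtain x where x: "x \<in> carrier V" "(\<lambda>n. cnorm V (f n \<ominus> x)) \<longlonglongrightarrow> 0"
    using Cauchy_convergent[of f] f by blast
  have "cnorm V (x \<ominus> f 0) \<le> cnorm V (f n \<ominus> x) + 2 * c" for n
    using cnorm_minus_triangle[of x "f n" "f 0"] dist'[of 0 n] cnorm_minus_commute[of x "f n"] f x
    by simp
  moreover have "(\<lambda>n. cnorm V (f n \<ominus> x) + 2 * c) \<longlonglongrightarrow> 0 + 2 * c"
    by (intro tendsto_intros x)
  ultimately have "cnorm V (x \<ominus> f 0) \<le> 2 * c" by (intro LIMSEQ_le_const) auto
  then show ?thesis using that x by blast
qed

section \<open>Finite operator families and their joint range\<close>

locale hilbert_operator_family = complex_hilbert_space V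
  for V :: "('a, 'm) cinner_space_scheme" (structure) +
  fixes I :: "'i set" and K :: "'i \<Rightarrow> ('k, 'n) cinner_space_scheme" and B :: "'i \<Rightarrow> 'k \<Rightarrow> 'a"
  assumes finite_index: "finite I"
    and hilbert: "i \<in> I \<Longrightarrow> complex_hilbert_space (K i)"
    and operator: "i \<in> I \<Longrightarrow> bounded_operator (K i) V (B i)"
begin

text \<open>This is the row operator from the direct sum of the spaces \<open>K i\<close>. The
  direct sum is not built as a Hilbert space: its vectors are the functions in
  \<open>coords\<close>, arbitrary off \<open>I\<close>, and norms are controlled one coordinate at
  a time.\<close>

definition synthesis :: "('i \<Rightarrow> 'k) \<Rightarrow> 'a" where
  "synthesis x = finsum V (\<lambda>i. B i (x i)) I"

abbreviation coords :: "('i \<Rightarrow> 'k) set" where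
  "coords \<equiv> Pi I (\<lambda>i. carrier (K i))"

abbreviation ran :: "'a set" where
  "ran \<equiv> algebraic_sum V I (\<lambda>i. B i ` carrier (K i))"

lemma inner: "i \<in> I \<Longrightarrow> complex_inner_space (K i)"
  using hilbert by (simp add: complex_hilbert_space_def)

lemmas operatorD = bounded_operatorD[OF operator]

lemma operator_minus:
  "i \<in> I \<Longrightarrow> v \<in> carrier (K i) \<Longrightarrow> w \<in> carrier (K i) \<Longrightarrow> B i (v \<ominus>\<^bsub>K i\<^esub> w) = B i v \<ominus> B i w"
  using bounded_operator_minus[OF operator inner complex_inner_space_axioms] by blast

lemma component: "x \<in> coords \<Longrightarrow> i \<in> I \<Longrightarrow> x i \<in> carrier (K i)"
  by (simp add: Pi_iff)

lemma component_ops: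
  "i \<in> I \<Longrightarrow> v \<in> carrier (K i) \<Longrightarrow> w \<in> carrier (K i) \<Longrightarrow> v \<ominus>\<^bsub>K i\<^esub> w \<in> carrier (K i)"
  "i \<in> I \<Longrightarrow> v \<in> carrier (K i) \<Longrightarrow> w \<in> carrier (K i) \<Longrightarrow> v \<oplus>\<^bsub>K i\<^esub> w \<in> carrier (K i)"
  "i \<in> I \<Longrightarrow> v \<in> carrier (K i) \<Longrightarrow> c \<odot>\<^bsub>K i\<^esub> v \<in> carrier (K i)"
  "i \<in> I \<Longrightarrow> \<zero>\<^bsub>K i\<^esub> \<in> carrier (K i)"
proof -
  assume i: "i \<in> I"
  interpret K: complex_hilbert_space "K i" using hilbert i .
  show "v \<ominus>\<^bsub>K i\<^esub> w \<in> carrier (K i)" if "v \<in> carrier (K i)" "w \<in> carrier (K i)" using that by simp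
  show "v \<oplus>\<^bsub>K i\<^esub> w \<in> carrier (K i)" if "v \<in> carrier (K i)" "w \<in> carrier (K i)" using that by simp
  show "c \<odot>\<^bsub>K i\<^esub> v \<in> carrier (K i)" if "v \<in> carrier (K i)" using that by (rule K.smult_in_carrier)
  show "\<zero>\<^bsub>K i\<^esub> \<in> carrier (K i)" by simp
qed

lemma synthesis_closed [simp]: "x \<in> coords \<Longrightarrow> synthesis x \<in> carrier V"
  unfolding synthesis_def using operatorD(1) by (intro finsum_in_carrier) (auto simp: component)

lemma cinner_synthesis:
  "x \<in> coords \<Longrightarrow> z \<in> carrier V \<Longrightarrow> cinner (synthesis x) z = (\<Sum>i\<in>I. cinner (B i (x i)) z)"
  unfolding synthesis_def
  using operatorD(1) finite_index by (intro cinner_finsum_left) (auto simp: component)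

lemma synthesis_add:
  assumes "x \<in> coords" "y \<in> coords"
  shows "synthesis (\<lambda>i. x i \<oplus>\<^bsub>K i\<^esub> y i) = synthesis x \<oplus> synthesis y"
proof (rule cinner_ext)
  have *: "(\<lambda>i. x i \<oplus>\<^bsub>K i\<^esub> y i) \<in> coords" using assms by (auto simp: component component_ops)
  then show "synthesis (\<lambda>i. x i \<oplus>\<^bsub>K i\<^esub> y i) \<in> carrier V" by simp
  show "cinner (synthesis (\<lambda>i. x i \<oplus>\<^bsub>K i\<^esub> y i)) z = cinner (synthesis x \<oplus> synthesis y) z"
    if "z \<in> carrier V" for z
    using assms that * operatorD
    by (simp add: cinner_synthesis cinner_add_left component flip: sum.distrib cong: sum.cong)
qed (use assms in auto)

lemma synthesis_minus:
  assumes "x \<in> coords" "y \<in> coords"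
  shows "synthesis (\<lambda>i. x i \<ominus>\<^bsub>K i\<^esub> y i) = synthesis x \<ominus> synthesis y"
proof (rule cinner_ext)
  have *: "(\<lambda>i. x i \<ominus>\<^bsub>K i\<^esub> y i) \<in> coords" using assms by (auto simp: component component_ops)
  then show "synthesis (\<lambda>i. x i \<ominus>\<^bsub>K i\<^esub> y i) \<in> carrier V" by simp
  show "cinner (synthesis (\<lambda>i. x i \<ominus>\<^bsub>K i\<^esub> y i)) z = cinner (synthesis x \<ominus> synthesis y) z"
    if "z \<in> carrier V" for z
    using assms that * operatorD(1)
    by (simp add: cinner_synthesis cinner_minus_left component operator_minus flip: sum_subtractf cong: sum.cong)
qed (use assms in auto)

lemma synthesis_smult:
  assumes "x \<in> coords"
  shows "synthesis (\<lambda>i. c \<odot>\<^bsub>K i\<^esub> x i) = c \<odot> synthesis x"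
proof (rule cinner_ext)
  have *: "(\<lambda>i. c \<odot>\<^bsub>K i\<^esub> x i) \<in> coords" using assms by (auto simp: component component_ops)
  then show "synthesis (\<lambda>i. c \<odot>\<^bsub>K i\<^esub> x i) \<in> carrier V" by simp
  show "cinner (synthesis (\<lambda>i. c \<odot>\<^bsub>K i\<^esub> x i)) z = cinner (c \<odot> synthesis x) z"
    if "z \<in> carrier V" for z
    using assms that * operatorD
    by (simp add: cinner_synthesis cinner_smult_left component sum_distrib_left cong: sum.cong)
qed (use assms in \<open>auto simp: smult_in_carrier\<close>)

lemma synthesis_zero: "synthesis (\<lambda>i. \<zero>\<^bsub>K i\<^esub>) = \<zero>"
proof -
  have *: "(\<lambda>i. \<zero>\<^bsub>K i\<^esub>) \<in> coords" by (auto simp: component component_ops)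
  have "\<zero>\<^bsub>K i\<^esub> \<ominus>\<^bsub>K i\<^esub> \<zero>\<^bsub>K i\<^esub> = \<zero>\<^bsub>K i\<^esub>" if i: "i \<in> I" for i
  proof -
    interpret K: complex_hilbert_space "K i" using hilbert i .
    show ?thesis by simp
  qed
  then have "B i \<zero>\<^bsub>K i\<^esub> = B i \<zero>\<^bsub>K i\<^esub> \<ominus> B i \<zero>\<^bsub>K i\<^esub>" if "i \<in> I" for i
    using operator_minus[OF that, of "\<zero>\<^bsub>K i\<^esub>" "\<zero>\<^bsub>K i\<^esub>"] that by (simp add: component_ops)
  then have "B i \<zero>\<^bsub>K i\<^esub> = \<zero>" if "i \<in> I" for i
    using that operatorD(1)[OF that component_ops(4)[OF that]]
    by (metis minus_eq_zero_iff)
  then show ?thesis using *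
    by (intro cinner_ext) (auto simp: cinner_synthesis)
qed

lemma ran_eq: "ran = synthesis ` coords"
proof (intro equalityI subsetI)
  fix y assume "y \<in> ran"
  then obtain f where f: "\<forall>i\<in>I. f i \<in> B i ` carrier (K i)" "y = finsum V f I"
    by (auto simp: algebraic_sum_def)
  then obtain x where x: "\<forall>i\<in>I. x i \<in> carrier (K i) \<and> f i = B i (x i)"
    unfolding image_iff Bex_def by (metis (no_types, lifting))
  have "y = synthesis x" unfolding synthesis_def f(2)
    using x operatorD(1) by (intro M.finsum_cong') auto
  then show "y \<in> synthesis ` coords" using x by auto
next
  fix y assume "y \<in> synthesis ` coords"
  then show "y \<in> ran" by (auto simp: algebraic_sum_def synthesis_def component)
qed

lemma csubspace_ran: "csubspace ran"
  unfolding csubspace_def ran_eq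
proof (intro conjI ballI allI)
  show "\<zero> \<in> synthesis ` coords" by (intro image_eqI[of _ _ "\<lambda>i. \<zero>\<^bsub>K i\<^esub>"]) (auto simp: synthesis_zero component_ops)
  fix y assume "y \<in> synthesis ` coords"
  then obtain x where x: "x \<in> coords" "y = synthesis x" by blast
  show "c \<odot> y \<in> synthesis ` coords" for c
    using x synthesis_smult[OF x(1), of c]
    by (intro image_eqI[of _ _ "\<lambda>i. c \<odot>\<^bsub>K i\<^esub> x i"]) (auto simp: component component_ops)
  fix y' assume "y' \<in> synthesis ` coords"
  then obtain x' where x': "x' \<in> coords" "y' = synthesis x'" by blast
  show "y \<oplus> y' \<in> synthesis ` coords"
    using x x' synthesis_add[OF x(1) x'(1)]
    by (intro image_eqI[of _ _ "\<lambda>i. x i \<oplus>\<^bsub>K i\<^esub> x' i"]) (auto simp: component component_ops)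
qed auto

text \<open>Continuity of \<open>synthesis\<close> in coordinate form: convergence of every
  coordinate forces convergence of the images.\<close>

lemma synthesis_bound:
  obtains C where "\<And>x. x \<in> coords \<Longrightarrow> cnorm V (synthesis x) \<le> (\<Sum>i\<in>I. C i * cnorm (K i) (x i))"
proof -
  have "\<exists>C. \<forall>x\<in>carrier (K i). cnorm V (B i x) \<le> C * cnorm (K i) x" if "i \<in> I" for i
    using operator[OF that] by (simp add: bounded_operator_def)
  then obtain C where C: "\<And>i x. i \<in> I \<Longrightarrow> x \<in> carrier (K i) \<Longrightarrow> cnorm V (B i x) \<le> C i * cnorm (K i) x"
    by metis
  show ?thesis
  proof (rule that[of C])
    fix x assume x: "x \<in> coords"
    have "cnorm V (synthesis x) \<le> (\<Sum>i\<in>I. cnorm V (B i (x i)))"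
      unfolding synthesis_def using x operatorD(1) finite_index
      by (intro cnorm_finsum_le) (auto simp: component)
    also have "\<dots> \<le> (\<Sum>i\<in>I. C i * cnorm (K i) (x i))"
      using x C by (intro sum_mono) (auto simp: component)
    finally show "cnorm V (synthesis x) \<le> (\<Sum>i\<in>I. C i * cnorm (K i) (x i))" .
  qed
qed

text \<open>A closed \<open>ran\<close> is a complete metric space covered by the closures of the
  images \<open>E n\<close> of boxes of size \<open>n\<close>. By Baire's theorem one of these
  closures contains a ball of \<open>ran\<close>; its points are limits of \<open>E n\<close>, hence
  the approximate form of the conclusion.\<close>

lemma ran_somewhere_dense:
  assumes closed: "closedin (norm_topology V) ran"
  obtains n :: nat and y0 r where "y0 \<in> ran" "r > 0"
    "\<And>y e. y \<in> ran \<Longrightarrow> cnorm V (y \<ominus> y0) < r \<Longrightarrow> e > 0 \<Longrightarrow>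
      \<exists>x\<in>coords. (\<forall>i\<in>I. cnorm (K i) (x i) \<le> real n) \<and> cnorm V (y \<ominus> synthesis x) < e"
proof -
  note ranV = csubspaceD(1)[OF csubspace_ran]
  define E where "E n = synthesis ` {x \<in> coords. \<forall>i\<in>I. cnorm (K i) (x i) \<le> real n}" for n
  let ?T = "subtopology (norm_topology V) ran"
  have topT: "topspace ?T = ran"
    using closedin_subset[OF closed] by auto
  have E_sub: "E n \<subseteq> ran" for n by (auto simp: E_def ran_eq)
  have "ran \<subseteq> (\<Union>n. ?T closure_of (E n))"
  proof
    fix y assume y: "y \<in> ran"
    then obtain x where x: "x \<in> coords" "y = synthesis x" by (auto simp: ran_eq)
    obtain n :: nat where n: "(\<Sum>i\<in>I. cnorm (K i) (x i)) \<le> real n" using real_arch_simple by blast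
    have "cnorm (K i) (x i) \<le> real n" if i: "i \<in> I" for i
    proof -
      have "cnorm (K i) (x i) \<le> (\<Sum>i\<in>I. cnorm (K i) (x i))"
        using i finite_index x complex_inner_space.cnorm_nonneg[OF inner]
        by (intro member_le_sum) (auto simp: component)
      then show ?thesis using n by simp
    qed
    then have "y \<in> E n" using x by (auto simp: E_def)
    then show "y \<in> (\<Union>n. ?T closure_of (E n))"
      using closure_of_subset[of "E n" ?T] E_sub topT by blast
  qed
  moreover have "(\<Union>n. ?T closure_of (E n)) \<subseteq> ran"
    using closure_of_subset_topspace[of ?T] topT by blast
  ultimately have UN: "(\<Union>n. ?T closure_of (E n)) = ran" by blast
  have "completely_metrizable_space ?T"
    using closed completely_metrizable_space_closedin metric.completely_metrizable_space_mtopology[OF complete]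
    by (simp add: norm_topology_def)
  \<comment> \<open>Baire's theorem would give the union an empty interior; the union is the whole
    space, which contains zero.\<close>
  moreover have "?T interior_of ran \<noteq> {}"
    using csubspaceD(2)[OF csubspace_ran] interior_of_topspace[of ?T] topT by auto
  moreover have "?T interior_of (\<Union>n. ?T closure_of (E n)) = {}"
    if "completely_metrizable_space ?T" "\<nexists>n. ?T interior_of (?T closure_of (E n)) \<noteq> {}"
    using that by (intro Baire_category_alt) auto
  ultimately have "\<exists>n. ?T interior_of (?T closure_of (E n)) \<noteq> {}"
    unfolding UN by blast
  then obtain n y0 where "y0 \<in> ?T interior_of (?T closure_of (E n))" by blast
  then obtain W where W: "openin ?T W" "y0 \<in> W" "W \<subseteq> ?T closure_of (E n)"
    by (auto simp: interior_of_def)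
  then obtain U where U: "openin (norm_topology V) U" "W = U \<inter> ran"
    by (auto simp: openin_subtopology)
  obtain r where r: "r > 0" "metric.mball y0 r \<subseteq> U"
    using U W(2) by (auto simp: norm_topology_def metric.openin_mtopology)
  show ?thesis
  proof (rule that[of y0 r n])
    show "y0 \<in> ran" using W U by auto
    fix y and e :: real assume y: "y \<in> ran" "cnorm V (y \<ominus> y0) < r" and e: "e > 0"
    have "y \<in> metric.mball y0 r"
      using y ranV \<open>y0 \<in> ran\<close> by (simp add: cdist_def cnorm_minus_commute)
    then have "y \<in> ?T closure_of (E n)" using r U W y by blast
    then have "y \<in> norm_topology V closure_of (E n)"
      by (metis closure_of_subtopology_subset subsetD)
    then obtain v where "v \<in> E n" "cdist V y v < e"
      using e unfolding norm_topology_def metric.metric_closure_of by auto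
    then show "\<exists>x\<in>coords. (\<forall>i\<in>I. cnorm (K i) (x i) \<le> real n) \<and> cnorm V (y \<ominus> synthesis x) < e"
      using ranV[OF y(1)] by (auto simp: E_def cdist_def)
  qed (use r in auto)
qed

text \<open>The ball around \<open>y0\<close> is transported to zero by subtracting approximate
  preimages of \<open>y0 \<oplus> y\<close> and \<open>y0\<close>, which doubles the box;
  homogeneity then reaches vectors of any norm.\<close>

lemma approximate_preimages:
  assumes closed: "closedin (norm_topology V) ran"
  obtains C where "C \<ge> 0" "\<And>y e. y \<in> ran \<Longrightarrow> e > 0 \<Longrightarrow>
    \<exists>x\<in>coords. (\<forall>i\<in>I. cnorm (K i) (x i) \<le> C * cnorm V y) \<and> cnorm V (y \<ominus> synthesis x) < e"
proof -
  note ran = csubspaceD[OF csubspace_ran]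
  obtain y0 r n where y0: "y0 \<in> ran" and r: "r > 0"
    and dense: "\<And>y e. y \<in> ran \<Longrightarrow> cnorm V (y \<ominus> y0) < r \<Longrightarrow> e > 0 \<Longrightarrow>
      \<exists>x\<in>coords. (\<forall>i\<in>I. cnorm (K i) (x i) \<le> real n) \<and> cnorm V (y \<ominus> synthesis x) < e"
    by (rule ran_somewhere_dense[OF closed]) (rule that; assumption)
  have ball: "\<exists>x\<in>coords. (\<forall>i\<in>I. cnorm (K i) (x i) \<le> 2 * real n) \<and> cnorm V (y \<ominus> synthesis x) < e"
    if y: "y \<in> ran" "cnorm V y < r" and e: "e > 0" for y e
  proof -
    have yV: "y \<in> carrier V" "y0 \<in> carrier V" using y y0 ran by auto
    have "(y0 \<oplus> y) \<ominus> y0 = y" using yV by (intro cinner_ext) (auto simp: cinner_linear)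
    moreover have "y0 \<oplus> y \<in> ran" using y y0 by (simp add: ran(3))
    ultimately obtain x1 where x1: "x1 \<in> coords" "\<forall>i\<in>I. cnorm (K i) (x1 i) \<le> real n"
      "cnorm V ((y0 \<oplus> y) \<ominus> synthesis x1) < e/2"
      using dense[of "y0 \<oplus> y" "e/2"] y(2) e by auto
    have "y0 \<ominus> y0 = \<zero>" using yV by (simp add: minus_eq_zero_iff)
    then obtain x2 where x2: "x2 \<in> coords" "\<forall>i\<in>I. cnorm (K i) (x2 i) \<le> real n"
      "cnorm V (y0 \<ominus> synthesis x2) < e/2"
      using dense[of y0 "e/2"] y0 e r by auto
    have "y \<ominus> (synthesis x1 \<ominus> synthesis x2) = ((y0 \<oplus> y) \<ominus> synthesis x1) \<ominus> (y0 \<ominus> synthesis x2)"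
      using yV x1 x2 by (intro cinner_ext) (auto simp: cinner_linear)
    then have "cnorm V (y \<ominus> (synthesis x1 \<ominus> synthesis x2)) \<le>
        cnorm V ((y0 \<oplus> y) \<ominus> synthesis x1) + cnorm V (y0 \<ominus> synthesis x2)"
      using cnorm_minus_le yV x1 x2 by simp
    moreover have "cnorm (K i) (x1 i \<ominus>\<^bsub>K i\<^esub> x2 i) \<le> 2 * real n" if i: "i \<in> I" for i
      using complex_inner_space.cnorm_minus_le[OF inner[OF i], of "x1 i" "x2 i"] x1 x2 i
      by (fastforce simp: component)
    ultimately show ?thesis using x1 x2
      by (intro bexI[of _ "\<lambda>i. x1 i \<ominus>\<^bsub>K i\<^esub> x2 i"]) (auto simp: synthesis_minus component component_ops)
  qed
  show ?thesis
  proof (rule that[of "4 * real n / r"])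
    fix y and e :: real assume y: "y \<in> ran" and e: "e > 0"
    have yV: "y \<in> carrier V" using ran y by auto
    show "\<exists>x\<in>coords. (\<forall>i\<in>I. cnorm (K i) (x i) \<le> 4 * real n / r * cnorm V y) \<and> cnorm V (y \<ominus> synthesis x) < e"
    proof (cases "cnorm V y = 0")
      case True
      then have "y = \<zero>" using yV cnorm_eq_zero_iff by blast
      moreover have "cnorm (K i) \<zero>\<^bsub>K i\<^esub> = 0" if "i \<in> I" for i
        using complex_inner_space.cnorm_zero[OF inner[OF that]] .
      ultimately show ?thesis using e
        by (intro bexI[of _ "\<lambda>i. \<zero>\<^bsub>K i\<^esub>"]) (auto simp: synthesis_zero component_ops)
    next
      case False
      \<comment> \<open>Scales \<open>y\<close> to norm \<open>r / 2\<close>, strictly inside the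
        ball. Scaling back multiplies \<open>2 * real n\<close> by \<open>1 / a\<close>, whence the
        constant \<open>4 * real n / r\<close>, and the tolerance by the same factor, whence
        \<open>e * a\<close>.\<close>
      define a where "a = r / (2 * cnorm V y)"
      have a: "a > 0" using False cnorm_nonneg[OF yV] r by (simp add: a_def)
      have "cnorm V (of_real a \<odot> y) = r / 2"
        using a False yV by (simp add: cnorm_smult) (simp add: a_def)
      then obtain x where x: "x \<in> coords" "\<forall>i\<in>I. cnorm (K i) (x i) \<le> 2 * real n"
        "cnorm V (of_real a \<odot> y \<ominus> synthesis x) < e * a"
        using ball[of "of_real a \<odot> y" "e * a"] y r e a ran(4) by auto
      have "y \<ominus> of_real (1/a) \<odot> synthesis x = of_real (1/a) \<odot> (of_real a \<odot> y \<ominus> synthesis x)"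
        using yV x a by (intro cinner_ext) (auto simp: cinner_linear algebra_simps)
      then have "cnorm V (y \<ominus> of_real (1/a) \<odot> synthesis x) < e"
        using x(3) a yV x(1) by (simp add: cnorm_smult smult_in_carrier norm_divide field_simps)
      moreover have "cnorm (K i) (of_real (1/a) \<odot>\<^bsub>K i\<^esub> x i) \<le> 4 * real n / r * cnorm V y"
        if i: "i \<in> I" for i
      proof -
        have "cnorm (K i) (of_real (1/a) \<odot>\<^bsub>K i\<^esub> x i) = (1/a) * cnorm (K i) (x i)"
          using complex_inner_space.cnorm_smult[OF inner[OF i] component[OF x(1) i], of "of_real (1/a)"] a
          by (simp add: norm_divide)
        also have "\<dots> \<le> (1/a) * (2 * real n)" using x i a by (intro mult_left_mono) auto
        also have "\<dots> = 4 * real n / r * cnorm V y" by (simp add: a_def)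
        finally show ?thesis .
      qed
      ultimately show ?thesis using x(1)
        by (intro bexI[of _ "\<lambda>i. of_real (1/a) \<odot>\<^bsub>K i\<^esub> x i"]) (auto simp: synthesis_smult component component_ops)
    qed
  qed (use r in simp)
qed

text \<open>The successive approximation of the open mapping theorem: each remainder gets an
  approximate preimage, the remainders shrink by powers of two, and summing the corrections doubles
  the constant.\<close>

lemma bounded_preimages:
  assumes closed: "closedin (norm_topology V) ran"
  obtains C where "C \<ge> 0" "\<And>y. y \<in> ran \<Longrightarrow>
    \<exists>x\<in>coords. (\<forall>i\<in>I. cnorm (K i) (x i) \<le> C * cnorm V y) \<and> synthesis x = y"
proof -
  note ran = csubspaceD[OF csubspace_ran]
  obtain C where C: "C \<ge> 0" and approx: "\<And>y e. y \<in> ran \<Longrightarrow> e > 0 \<Longrightarrow>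
    \<exists>x\<in>coords. (\<forall>i\<in>I. cnorm (K i) (x i) \<le> C * cnorm V y) \<and> cnorm V (y \<ominus> synthesis x) < e"
    using approximate_preimages[OF closed] by blast
  show ?thesis
  proof (rule that[of "2 * C"])
    fix y assume y: "y \<in> ran"
    have yV: "y \<in> carrier V" using ran y by auto
    show "\<exists>x\<in>coords. (\<forall>i\<in>I. cnorm (K i) (x i) \<le> 2 * C * cnorm V y) \<and> synthesis x = y"
    proof (cases "cnorm V y = 0")
      case True
      then have "y = \<zero>" using yV cnorm_eq_zero_iff by blast
      moreover have "cnorm (K i) \<zero>\<^bsub>K i\<^esub> = 0" if "i \<in> I" for i
        using complex_inner_space.cnorm_zero[OF inner[OF that]] .
      ultimately show ?thesis
        by (intro bexI[of _ "\<lambda>i. \<zero>\<^bsub>K i\<^esub>"]) (auto simp: synthesis_zero component_ops)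
    next
      case False
      define \<delta> where "\<delta> = cnorm V y"
      have \<delta>: "\<delta> > 0" using False cnorm_nonneg[OF yV] by (simp add: \<delta>_def)
      \<comment> \<open>The tolerance depends on the stage only, and is positive because the case of
        norm zero has been split off. The implication under the quantifier lets choice produce a
        total \<open>G\<close>.\<close>
      have "\<forall>w n. \<exists>x. w \<in> ran \<longrightarrow> x \<in> coords \<and> (\<forall>i\<in>I. cnorm (K i) (x i) \<le> C * cnorm V w) \<and>
          cnorm V (w \<ominus> synthesis x) < \<delta> / 2 ^ Suc n"
        using approx[OF _ divide_pos_pos[OF \<delta>]] by (meson zero_less_numeral zero_less_power)
      then obtain G where G: "\<And>w n. w \<in> ran \<Longrightarrow> G w n \<in> coords"
        "\<And>w n i. w \<in> ran \<Longrightarrow> i \<in> I \<Longrightarrow> cnorm (K i) (G w n i) \<le> C * cnorm V w"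
        "\<And>w n. w \<in> ran \<Longrightarrow> cnorm V (w \<ominus> synthesis (G w n)) < \<delta> / 2 ^ Suc n"
        unfolding choice_iff by blast
      \<comment> \<open>Partial sums of the corrections; \<open>G\<close> is applied to the
        remainder left by the sum so far.\<close>
      define p where "p = rec_nat (\<lambda>i. \<zero>\<^bsub>K i\<^esub>)
        (\<lambda>n x i. x i \<oplus>\<^bsub>K i\<^esub> G (y \<ominus> synthesis x) n i)"
      define R where "R n = y \<ominus> synthesis (p n)" for n
      have p0: "p 0 = (\<lambda>i. \<zero>\<^bsub>K i\<^esub>)" and pSuc: "p (Suc n) = (\<lambda>i. p n i \<oplus>\<^bsub>K i\<^esub> G (R n) n i)" for n
        by (simp_all add: p_def R_def)
      have R_ran: "R n \<in> ran" if "p n \<in> coords" for n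
        using csubspace_minus[OF csubspace_ran y, of "synthesis (p n)"] that by (auto simp: R_def ran_eq)
      have pX: "p n \<in> coords" for n
      proof (induction n)
        case (Suc n)
        then show ?case using G(1)[OF R_ran, of n n]
          by (auto simp: pSuc component component_ops)
      qed (auto simp: p0 component_ops)
      note R = R_ran[OF pX]
      have RV: "R n \<in> carrier V" for n using R ran by auto
      have R_Suc: "R (Suc n) = R n \<ominus> synthesis (G (R n) n)" for n
      proof -
        define g where "g = G (R n) n"
        have g: "g \<in> coords" unfolding g_def by (rule G(1)[OF R])
        have "synthesis (p (Suc n)) = synthesis (p n) \<oplus> synthesis g"
          unfolding pSuc g_def by (rule synthesis_add[OF pX G(1)[OF R]])
        then have "y \<ominus> synthesis (p (Suc n)) = (y \<ominus> synthesis (p n)) \<ominus> synthesis g"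
          using yV pX g by (intro cinner_ext) (auto simp: cinner_linear)
        then show ?thesis by (simp add: R_def g_def)
      qed
      have R_le: "cnorm V (R n) \<le> \<delta> / 2 ^ n" for n
      proof (cases n)
        case 0
        then show ?thesis using yV by (simp add: R_def p0 synthesis_zero \<delta>_def)
      next
        case (Suc k)
        then show ?thesis using G(3)[OF R, of k k] by (simp add: R_Suc less_imp_le)
      qed
      \<comment> \<open>The \<open>n\<close>-th correction has norm at most
        \<open>C * \<delta> / 2 ^ n\<close>, and the series starts at zero, so
        \<open>geometric_convergent\<close> bounds the limit itself.\<close>
      have "\<exists>x. x \<in> carrier (K i) \<and> (\<lambda>n. cnorm (K i) (p n i \<ominus>\<^bsub>K i\<^esub> x)) \<longlonglongrightarrow> 0 \<and>
          cnorm (K i) x \<le> 2 * C * \<delta>" if i: "i \<in> I" for i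
      proof -
        interpret K: complex_hilbert_space "K i" using hilbert i .
        have pK: "p n i \<in> carrier (K i)" for n using pX i by (simp add: component)
        have "cnorm (K i) (p (Suc n) i \<ominus>\<^bsub>K i\<^esub> p n i) \<le> C * \<delta> / 2 ^ n" for n
        proof -
          have "G (R n) n i \<in> carrier (K i)" using G(1)[OF R] i by (simp add: component)
          then have "p (Suc n) i \<ominus>\<^bsub>K i\<^esub> p n i = G (R n) n i"
            using pK by (intro K.cinner_ext) (auto simp: pSuc K.cinner_linear)
          then have "cnorm (K i) (p (Suc n) i \<ominus>\<^bsub>K i\<^esub> p n i) \<le> C * cnorm V (R n)"
            using G(2)[OF R i] by simp
          also have "\<dots> \<le> C * (\<delta> / 2 ^ n)" using R_le C by (rule mult_left_mono)
          finally show ?thesis by simp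
        qed
        from K.geometric_convergent[of "\<lambda>n. p n i", OF pK this]
        obtain x where "x \<in> carrier (K i)" "(\<lambda>n. cnorm (K i) (p n i \<ominus>\<^bsub>K i\<^esub> x)) \<longlonglongrightarrow> 0"
          "cnorm (K i) (x \<ominus>\<^bsub>K i\<^esub> p 0 i) \<le> 2 * (C * \<delta>)" by blast
        then show ?thesis by (auto simp: p0)
      qed
      then obtain x where x: "\<And>i. i \<in> I \<Longrightarrow> x i \<in> carrier (K i)"
        "\<And>i. i \<in> I \<Longrightarrow> (\<lambda>n. cnorm (K i) (p n i \<ominus>\<^bsub>K i\<^esub> x i)) \<longlonglongrightarrow> 0"
        "\<And>i. i \<in> I \<Longrightarrow> cnorm (K i) (x i) \<le> 2 * C * \<delta>" by metis
      have xX: "x \<in> coords" using x by auto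
      obtain D where D: "\<And>x. x \<in> coords \<Longrightarrow> cnorm V (synthesis x) \<le> (\<Sum>i\<in>I. D i * cnorm (K i) (x i))"
        using synthesis_bound by blast
      have "(\<lambda>n. \<Sum>i\<in>I. D i * cnorm (K i) (p n i \<ominus>\<^bsub>K i\<^esub> x i)) \<longlonglongrightarrow> (\<Sum>i\<in>I. D i * 0)"
        by (intro tendsto_intros x)
      then have Dlim: "(\<lambda>n. \<Sum>i\<in>I. D i * cnorm (K i) (p n i \<ominus>\<^bsub>K i\<^esub> x i)) \<longlonglongrightarrow> 0" by simp
      have "cnorm V (synthesis (p n) \<ominus> synthesis x) \<le> (\<Sum>i\<in>I. D i * cnorm (K i) (p n i \<ominus>\<^bsub>K i\<^esub> x i))" for n
        unfolding synthesis_minus[OF pX xX, symmetric]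
        using pX xX by (intro D) (auto simp: component component_ops)
      then have lim1: "(\<lambda>n. cnorm V (synthesis (p n) \<ominus> synthesis x)) \<longlonglongrightarrow> 0"
        using pX xX cnorm_nonneg by (intro tendsto_sandwich[OF _ _ tendsto_const Dlim]) auto
      have geo: "(\<lambda>n. \<delta> / 2 ^ n) \<longlonglongrightarrow> 0"
        by (intro LIMSEQ_divide_realpow_zero) simp
      have "cnorm V (synthesis (p n) \<ominus> y) \<le> \<delta> / 2 ^ n" for n
        using R_le[of n] cnorm_minus_commute[of y "synthesis (p n)"] pX yV by (simp add: R_def)
      then have lim2: "(\<lambda>n. cnorm V (synthesis (p n) \<ominus> y)) \<longlonglongrightarrow> 0"
        using pX yV cnorm_nonneg by (intro tendsto_sandwich[OF _ _ tendsto_const geo]) auto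
      have "synthesis x = y"
        using cnorm_limit_unique[OF _ _ yV lim1 lim2] pX xX by simp
      then show ?thesis using x xX by (auto simp: \<delta>_def)
    qed
  qed (use C in simp)
qed

end

section \<open>Sums over families\<close>

context complex_inner_space
begin

lemma algebraic_sum_in_carrier:
  "(\<And>i. i \<in> I \<Longrightarrow> F i \<subseteq> carrier V) \<Longrightarrow> algebraic_sum V I F \<subseteq> carrier V"
  by (auto simp: algebraic_sum_def intro!: finsum_in_carrier)

lemma algebraic_sum_empty: "algebraic_sum V {} F = {\<zero>}"
  by (simp add: algebraic_sum_def M.finsum_empty)

lemma algebraic_sum_Un_disjoint:
  assumes fin: "finite I" "finite J" "I \<inter> J = {}" and F: "\<And>i. i \<in> I \<union> J \<Longrightarrow> F i \<subseteq> carrier V"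
  shows "algebraic_sum V (I \<union> J) F =
    {s \<oplus> t | s t. s \<in> algebraic_sum V I F \<and> t \<in> algebraic_sum V J F}"
proof (intro equalityI subsetI)
  fix y assume "y \<in> algebraic_sum V (I \<union> J) F"
  then obtain f where f: "\<forall>i\<in>I\<union>J. f i \<in> F i" "y = finsum V f (I \<union> J)"
    by (auto simp: algebraic_sum_def)
  have "y = finsum V f I \<oplus> finsum V f J"
    unfolding f(2) using f(1) F fin by (intro M.finsum_Un_disjoint) auto
  moreover have "finsum V f I \<in> algebraic_sum V I F" "finsum V f J \<in> algebraic_sum V J F"
    using f(1) by (auto simp: algebraic_sum_def)
  ultimately show "y \<in> {s \<oplus> t | s t. s \<in> algebraic_sum V I F \<and> t \<in> algebraic_sum V J F}"
    by blast
next
  fix y assume "y \<in> {s \<oplus> t | s t. s \<in> algebraic_sum V I F \<and> t \<in> algebraic_sum V J F}"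
  then obtain f g where f: "\<forall>i\<in>I. f i \<in> F i" and g: "\<forall>i\<in>J. g i \<in> F i"
    and y: "y = finsum V f I \<oplus> finsum V g J"
    by (auto simp: algebraic_sum_def)
  define h where "h i = (if i \<in> I then f i else g i)" for i
  have h: "\<forall>i\<in>I\<union>J. h i \<in> F i" using f g by (auto simp: h_def)
  have "finsum V h (I \<union> J) = finsum V h I \<oplus> finsum V h J"
    using h F fin by (intro M.finsum_Un_disjoint) auto
  also have "finsum V h I = finsum V f I"
    using f F by (intro M.finsum_cong') (auto simp: h_def)
  also have "finsum V h J = finsum V g J"
    using g F fin(3) by (intro M.finsum_cong') (auto simp: h_def)
  finally show "y \<in> algebraic_sum V (I \<union> J) F"
    using h unfolding y algebraic_sum_def by (intro CollectI exI[of _ h]) auto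
qed

lemma algebraic_sum_singleton:
  assumes "F i \<subseteq> carrier V"
  shows "algebraic_sum V {i} F = F i"
proof -
  have "finsum V f {i} = f i" if "f i \<in> F i" for f
    using that assms M.finsum_insert[of "{}" i f] by (auto simp: M.finsum_empty)
  then show ?thesis by (force simp: algebraic_sum_def)
qed

lemma algebraic_sum_Pair_image:
  assumes "\<And>i. i \<in> Q \<Longrightarrow> F p i \<subseteq> carrier V"
  shows "algebraic_sum V (Pair p ` Q) (\<lambda>(p, i). F p i) = algebraic_sum V Q (F p)"
proof -
  have reindex: "finsum V f (Pair p ` Q) = finsum V (\<lambda>i. f (p, i)) Q"
    if "\<forall>i\<in>Q. f (p, i) \<in> F p i" for f
    using that assms by (intro M.finsum_reindex) (auto simp: inj_on_def)
  show ?thesis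
  proof (intro equalityI subsetI)
    fix y assume "y \<in> algebraic_sum V (Pair p ` Q) (\<lambda>(p, i). F p i)"
    then obtain f where f: "\<forall>i\<in>Q. f (p, i) \<in> F p i" "y = finsum V f (Pair p ` Q)"
      by (auto simp: algebraic_sum_def)
    then show "y \<in> algebraic_sum V Q (F p)"
      using reindex[OF f(1)] by (auto simp: algebraic_sum_def)
  next
    fix y assume "y \<in> algebraic_sum V Q (F p)"
    then obtain f where f: "\<forall>i\<in>Q. f i \<in> F p i" "y = finsum V f Q"
      by (auto simp: algebraic_sum_def)
    then show "y \<in> algebraic_sum V (Pair p ` Q) (\<lambda>(p, i). F p i)"
      using reindex[of "\<lambda>(q, i). f i"]
      by (auto simp: algebraic_sum_def intro!: exI[of _ "\<lambda>(q, i). f i"])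
  qed
qed

text \<open>Flattening presents a sum of several groups of ranges as the range of a single family,
  the form that the Baire argument can handle.\<close>

lemma algebraic_sum_Sigma:
  assumes "finite P" "\<And>p. p \<in> P \<Longrightarrow> finite (Q p)"
    "\<And>p i. p \<in> P \<Longrightarrow> i \<in> Q p \<Longrightarrow> F p i \<subseteq> carrier V"
  shows "algebraic_sum V (Sigma P Q) (\<lambda>(p, i). F p i) =
    algebraic_sum V P (\<lambda>p. algebraic_sum V (Q p) (F p))"
  using assms
proof (induction P)
  case empty
  show ?case by (simp add: algebraic_sum_empty)
next
  case (insert p P)
  let ?G = "\<lambda>p. algebraic_sum V (Q p) (F p)" and ?F = "\<lambda>(p, i). F p i"
  have G: "?G q \<subseteq> carrier V" if "q \<in> insert p P" for q
    using insert.prems that by (intro algebraic_sum_in_carrier) auto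
  have F: "x \<in> carrier V" if "q \<in> insert p P" "i \<in> Q q" "x \<in> F q i" for q i x
    using insert.prems(2)[OF that(1,2)] that(3) by blast
  have "Sigma (insert p P) Q = Pair p ` Q p \<union> Sigma P Q" by auto
  then have "algebraic_sum V (Sigma (insert p P) Q) ?F =
      {s \<oplus> t | s t. s \<in> algebraic_sum V (Pair p ` Q p) ?F \<and> t \<in> algebraic_sum V (Sigma P Q) ?F}"
    using insert.hyps insert.prems(1) by (subst algebraic_sum_Un_disjoint[symmetric]) (auto intro: F)
  also have "\<dots> = {s \<oplus> t | s t. s \<in> algebraic_sum V {p} ?G \<and> t \<in> algebraic_sum V P ?G}"
    using insert G by (simp add: algebraic_sum_Pair_image algebraic_sum_singleton)
  also have "\<dots> = algebraic_sum V ({p} \<union> P) ?G"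
    using insert.hyps G by (intro algebraic_sum_Un_disjoint[symmetric]) auto
  finally show ?case by simp
qed

end

context complex_hilbert_space
begin

text \<open>With \<open>u\<close> synthesized from \<open>w\<close> and a difference of the
  \<open>t n\<close> from \<open>d\<close>, the pairing becomes the double sum of the pairings of
  \<open>w i\<close> with \<open>T i j (d j)\<close>. Bounded preimages control \<open>w\<close> by
  the norm of \<open>u\<close>; compactness makes the second factors small along a common
  subsequence.\<close>

lemma closed_sum_of_families:
  assumes I: "hilbert_operator_family V I K B" "closedin (norm_topology V) (algebraic_sum V I (\<lambda>i. B i ` carrier (K i)))"
    and J: "hilbert_operator_family V J K B" "closedin (norm_topology V) (algebraic_sum V J (\<lambda>i. B i ` carrier (K i)))"
    and disj: "I \<inter> J = {}"
    and compact: "\<And>i j. i \<in> I \<Longrightarrow> j \<in> J \<Longrightarrow>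
      compact_operator (K j) (K i) (hilbert_adjoint (K i) V (B i) \<circ> B j)"
  shows "closedin (norm_topology V) (algebraic_sum V (I \<union> J) (\<lambda>i. B i ` carrier (K i)))"
proof -
  interpret I: hilbert_operator_family V I K B by fact
  interpret J: hilbert_operator_family V J K B by fact
  define T where "T i j = hilbert_adjoint (K i) V (B i) \<circ> B j" for i j
  have T: "compact_operator (K j) (K i) (T i j)" if "i \<in> I" "j \<in> J" for i j
    unfolding T_def using compact that .
  have bT: "bounded_operator (K j) (K i) (T i j)" if "i \<in> I" "j \<in> J" for i j
    using T[OF that] by (simp add: compact_operator_def)
  have adj: "cinner (B i v) (B j w) = cinner\<^bsub>K i\<^esub> v (T i j w)"
    if "i \<in> I" "j \<in> J" "v \<in> carrier (K i)" "w \<in> carrier (K j)" for i j v w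
    using hilbert_adjoint(2)[OF I.hilbert complex_inner_space_axioms I.operator J.operatorD(1)] that
    by (simp add: T_def)
  obtain C where C: "C \<ge> 0" and preI: "\<And>y. y \<in> I.ran \<Longrightarrow>
    \<exists>x\<in>I.coords. (\<forall>i\<in>I. cnorm (K i) (x i) \<le> C * cnorm V y) \<and> I.synthesis x = y"
    using I.bounded_preimages[OF I(2)] by blast
  obtain D where D: "D \<ge> 0" and preJ: "\<And>y. y \<in> J.ran \<Longrightarrow>
    \<exists>x\<in>J.coords. (\<forall>i\<in>J. cnorm (K i) (x i) \<le> D * cnorm V y) \<and> J.synthesis x = y"
    using J.bounded_preimages[OF J(2)] by blast
  have "closedin (norm_topology V) {s \<oplus> t | s t. s \<in> I.ran \<and> t \<in> J.ran}"
  proof (rule closed_sum_of_subspaces[OF I.csubspace_ran I(2) J.csubspace_ran J(2)])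
    fix t :: "nat \<Rightarrow> 'a"
    assume t: "\<And>n. t n \<in> J.ran \<and> cnorm V (t n) \<le> 1"
    have "\<exists>x\<in>J.coords. (\<forall>j\<in>J. cnorm (K j) (x j) \<le> D) \<and> J.synthesis x = t n" for n
    proof -
      obtain x where x: "x \<in> J.coords" "\<forall>j\<in>J. cnorm (K j) (x j) \<le> D * cnorm V (t n)" "J.synthesis x = t n"
        using preJ t by blast
      have "D * cnorm V (t n) \<le> D" using t[of n] D by (simp add: mult_left_le)
      then show ?thesis using x by (meson order_trans)
    qed
    then obtain x where x: "\<And>n. x n \<in> J.coords" "\<And>n j. j \<in> J \<Longrightarrow> cnorm (K j) (x n j) \<le> D"
      and xt: "\<And>n. J.synthesis (x n) = t n" by metis
    have xK: "x n j \<in> carrier (K j)" if "j \<in> J" for n j using J.component[OF x(1) that] .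
    \<comment> \<open>The Cauchy form is chosen because only differences of members of the sequence
      are estimated afterwards.\<close>
    define Q where "Q = (\<lambda>(i, j) (f :: nat \<Rightarrow> nat). \<forall>e>0. \<exists>N::nat. \<forall>k\<ge>N. \<forall>l\<ge>N.
      cnorm (K i) (T i j (x (f k) j) \<ominus>\<^bsub>K i\<^esub> T i j (x (f l) j)) < e)"
    have "\<exists>r. strict_mono r \<and> (\<forall>ij\<in>I \<times> J. Q ij r)"
    proof (rule common_subseq)
      fix ij and f :: "nat \<Rightarrow> nat" assume "ij \<in> I \<times> J" "strict_mono f"
      then obtain i j where ij: "ij = (i, j)" "i \<in> I" "j \<in> J" by auto
      interpret Ki: complex_hilbert_space "K i" using I.hilbert ij(2) .
      have TK: "T i j (x n j) \<in> carrier (K i)" for n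
        using bounded_operatorD(1)[OF bT] xK ij by blast
      obtain r l where r: "strict_mono r" "l \<in> carrier (K i)"
        "(\<lambda>n. cnorm (K i) (T i j (x (f (r n)) j) \<ominus>\<^bsub>K i\<^esub> l)) \<longlonglongrightarrow> 0"
        using compact_operator_subseq[OF J.inner[OF ij(3)] I.inner[OF ij(2)] T[OF ij(2,3)],
            of "\<lambda>n. x (f n) j" D] x(2) xK ij by blast
      have "Q ij (f \<circ> r)"
        using Ki.convergent_Cauchy[of "\<lambda>n. T i j (x (f (r n)) j)", OF TK r(2,3)]
        by (simp add: Q_def ij(1))
      then show "\<exists>r :: nat \<Rightarrow> nat. strict_mono r \<and> Q ij (f \<circ> r)" using r(1) by blast
    next
      fix ij f and r :: "nat \<Rightarrow> nat" assume Qf: "Q ij f" and r: "strict_mono r"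
      obtain i j where ij: "ij = (i, j)" by (cases ij)
      show "Q ij (f \<circ> r)"
        unfolding Q_def ij prod.case
      proof (intro allI impI)
        fix e :: real assume "e > 0"
        then obtain N where N: "\<And>k l. k \<ge> N \<Longrightarrow> l \<ge> N \<Longrightarrow>
            cnorm (K i) (T i j (x (f k) j) \<ominus>\<^bsub>K i\<^esub> T i j (x (f l) j)) < e"
          using Qf unfolding Q_def ij prod.case by blast
        have "r k \<ge> N" if "k \<ge> N" for k
          using that strict_mono_imp_increasing[OF r, of k] by simp
        then show "\<exists>N. \<forall>k\<ge>N. \<forall>l\<ge>N.
            cnorm (K i) (T i j (x ((f \<circ> r) k) j) \<ominus>\<^bsub>K i\<^esub> T i j (x ((f \<circ> r) l) j)) < e"
          using N by (intro exI[of _ N]) simp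
      qed
    qed (use I.finite_index J.finite_index in simp)
    then obtain r where r: "strict_mono r" and Q: "\<And>i j. i \<in> I \<Longrightarrow> j \<in> J \<Longrightarrow> Q (i, j) r"
      by blast
    have "\<exists>M. \<forall>k\<ge>M. \<forall>l\<ge>M. \<forall>u\<in>I.ran. cmod (cinner u (t (r k) \<ominus> t (r l))) \<le> e * cnorm V u"
      if e: "e > 0" for e
    proof -
      \<comment> \<open>One contribution \<open>C * cnorm V u * e'\<close> arises for each pair
        \<open>(i, j)\<close>; the added 1 keeps \<open>c\<close> positive even if \<open>C\<close>
        is zero or a family is empty, as at the start of the final induction.\<close>
      define c where "c = real (card I * card J) * C + 1"
      have c: "c > 0" using C by (simp add: c_def add_nonneg_pos)
      define e' where "e' = e / c"
      have e': "e' > 0" using e c by (simp add: e'_def)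
      have "\<exists>N. \<forall>k\<ge>N. \<forall>l\<ge>N. cnorm (K i) (T i j (x (r k) j) \<ominus>\<^bsub>K i\<^esub> T i j (x (r l) j)) < e'"
        if "i \<in> I" "j \<in> J" for i j
        using Q[OF that] e' unfolding Q_def prod.case by blast
      then obtain N where N: "\<And>i j k l. i \<in> I \<Longrightarrow> j \<in> J \<Longrightarrow> k \<ge> N i j \<Longrightarrow> l \<ge> N i j \<Longrightarrow>
          cnorm (K i) (T i j (x (r k) j) \<ominus>\<^bsub>K i\<^esub> T i j (x (r l) j)) < e'"
        by metis
      \<comment> \<open>A sum of natural numbers dominates each of them and, unlike a maximum, is
        defined for empty index sets.\<close>
      define M where "M = (\<Sum>i\<in>I. \<Sum>j\<in>J. N i j)"
      have M: "N i j \<le> M" if "i \<in> I" "j \<in> J" for i j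
      proof -
        have "N i j \<le> (\<Sum>j\<in>J. N i j)" using that J.finite_index by (intro member_le_sum) auto
        also have "\<dots> \<le> M" unfolding M_def using that I.finite_index
          by (intro member_le_sum[of i I "\<lambda>i. \<Sum>j\<in>J. N i j"]) auto
        finally show ?thesis .
      qed
      have "cmod (cinner u (t (r k) \<ominus> t (r l))) \<le> e * cnorm V u"
        if kl: "k \<ge> M" "l \<ge> M" and u: "u \<in> I.ran" for k l u
      proof -
        obtain w where w: "w \<in> I.coords" "\<forall>i\<in>I. cnorm (K i) (w i) \<le> C * cnorm V u" "I.synthesis w = u"
          using preI[OF u] by blast
        have uV: "u \<in> carrier V" using w by auto
        define d where "d j = x (r k) j \<ominus>\<^bsub>K j\<^esub> x (r l) j" for j
        have d: "d \<in> J.coords" using xK J.component_ops(1) by (auto simp: d_def)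
        have td: "t (r k) \<ominus> t (r l) = J.synthesis d"
          unfolding d_def using J.synthesis_minus[OF x(1) x(1)] by (simp add: xt)
        have "cinner (B i (w i)) (J.synthesis d) = (\<Sum>j\<in>J. cinner (B i (w i)) (B j (d j)))"
          if i: "i \<in> I" for i
        proof -
          have Bw: "B i (w i) \<in> carrier V" using I.operatorD(1)[OF i I.component[OF w(1) i]] .
          have Bd: "B j (d j) \<in> carrier V" if "j \<in> J" for j
            using J.operatorD(1)[OF that J.component[OF d that]] .
          \<comment> \<open>\<open>cinner_synthesis\<close> expands the first argument only, hence
            the detour through conjugates.\<close>
          have "cinner (B i (w i)) (J.synthesis d) = cnj (\<Sum>j\<in>J. cinner (B j (d j)) (B i (w i)))"
            using Bw d cinner_commute[of "J.synthesis d" "B i (w i)"] by (simp add: J.cinner_synthesis)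
          also have "\<dots> = (\<Sum>j\<in>J. cinner (B i (w i)) (B j (d j)))"
            using Bw Bd by (auto intro!: sum.cong simp: cinner_commute[symmetric])
          finally show ?thesis .
        qed
        then have "cinner u (t (r k) \<ominus> t (r l)) = (\<Sum>i\<in>I. \<Sum>j\<in>J. cinner (B i (w i)) (B j (d j)))"
          unfolding td w(3)[symmetric] using w(1) d by (simp add: I.cinner_synthesis)
        also have "cmod \<dots> \<le> (\<Sum>i\<in>I. \<Sum>j\<in>J. (C * cnorm V u) * e')"
        proof (intro sum_norm_le)
          fix i j assume ij: "i \<in> I" "j \<in> J"
          interpret Ki: complex_hilbert_space "K i" using I.hilbert ij(1) .
          have wK: "w i \<in> carrier (K i)" and dK: "d j \<in> carrier (K j)"
            using I.component[OF w(1) ij(1)] J.component[OF d ij(2)] .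
          have Td: "T i j (d j) = T i j (x (r k) j) \<ominus>\<^bsub>K i\<^esub> T i j (x (r l) j)"
            unfolding d_def
            using bounded_operator_minus[OF bT[OF ij] J.inner[OF ij(2)] I.inner[OF ij(1)] xK[OF ij(2)] xK[OF ij(2)]] .
          have "k \<ge> N i j" "l \<ge> N i j" using M[OF ij] kl by auto
          then have Te: "cnorm (K i) (T i j (d j)) \<le> e'" using N[OF ij] unfolding Td by (simp add: less_imp_le)
          have TK: "T i j (d j) \<in> carrier (K i)" using bounded_operatorD(1)[OF bT[OF ij] dK] .
          have "cmod (cinner (B i (w i)) (B j (d j))) \<le> cnorm (K i) (w i) * cnorm (K i) (T i j (d j))"
            unfolding adj[OF ij wK dK] using wK TK by (rule Ki.Cauchy_Schwarz)
          also have "\<dots> \<le> (C * cnorm V u) * e'"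
            using w(2) ij(1) Te C cnorm_nonneg[OF uV] Ki.cnorm_nonneg[OF TK] by (intro mult_mono) auto
          finally show "cmod (cinner (B i (w i)) (B j (d j))) \<le> (C * cnorm V u) * e'" .
        qed
        also have "\<dots> = (real (card I * card J) * C) * e' * cnorm V u" by simp
        also have "\<dots> \<le> c * e' * cnorm V u"
          using e' cnorm_nonneg[OF uV] by (intro mult_right_mono) (auto simp: c_def)
        also have "c * e' = e" using c by (simp add: e'_def)
        finally show ?thesis .
      qed
      then show ?thesis by blast
    qed
    then show "\<exists>r :: nat \<Rightarrow> nat. strict_mono r \<and> (\<forall>e>0. \<exists>N. \<forall>k\<ge>N. \<forall>l\<ge>N. \<forall>u\<in>I.ran.
        cmod (cinner u (t (r k) \<ominus> t (r l))) \<le> e * cnorm V u)"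
      using r by (intro exI[of _ r] conjI allI impI) auto
  qed
  also have "{s \<oplus> t | s t. s \<in> I.ran \<and> t \<in> J.ran} = algebraic_sum V (I \<union> J) (\<lambda>i. B i ` carrier (K i))"
    using I.finite_index J.finite_index disj I.operatorD(1) J.operatorD(1)
    by (intro algebraic_sum_Un_disjoint[symmetric]) auto
  finally show ?thesis .
qed

end

theorem theorem2:
  fixes m :: nat and N :: "nat \<Rightarrow> nat"
    and H :: "'h cinner_space"
    and K :: "nat \<Rightarrow> nat \<Rightarrow> 'k cinner_space"
    and A :: "nat \<Rightarrow> nat \<Rightarrow> 'k \<Rightarrow> 'h"
  assumes "m \<ge> 1"
    and "\<And>p. p \<in> {1..m} \<Longrightarrow> N p \<ge> 1"
    and "complex_hilbert_space H"
    and "\<And>p i. \<lbrakk>p \<in> {1..m}; i \<in> {1..N p}\<rbrakk> \<Longrightarrow> complex_hilbert_space (K p i)"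
    and "\<And>p i. \<lbrakk>p \<in> {1..m}; i \<in> {1..N p}\<rbrakk> \<Longrightarrow> bounded_operator (K p i) H (A p i)"
    and "\<And>p q i j. \<lbrakk>p \<in> {1..m}; q \<in> {1..m}; p \<noteq> q; i \<in> {1..N p}; j \<in> {1..N q}\<rbrakk>
          \<Longrightarrow> compact_operator (K q j) (K p i) (hilbert_adjoint (K p i) H (A p i) \<circ> A q j)"
    and "\<And>p. p \<in> {1..m} \<Longrightarrow> closedin (norm_topology H)
          (algebraic_sum H {1..N p} (\<lambda>i. A p i ` carrier (K p i)))"
  shows "closedin (norm_topology H) 
    (algebraic_sum H {1..m} (\<lambda>p. algebraic_sum H {1..N p} (\<lambda>i. A p i ` carrier (K p i))))"
proof -
  interpret H: complex_hilbert_space H by fact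
  \<comment> \<open>Pairs turn the doubly indexed data into one family, over which the partial sums
    form subfamilies \<open>S P\<close>.\<close>
  define K' where "K' = (\<lambda>(p, i). K p i)"
  define B where "B = (\<lambda>(p, i). A p i)"
  define S where "S P = Sigma P (\<lambda>p. {1..N p})" for P
  have ran: "A p i ` carrier (K p i) \<subseteq> carrier H" if "p \<in> {1..m}" "i \<in> {1..N p}" for p i
    using bounded_operatorD(1)[OF assms(5)[OF that]] by auto
  have sum: "algebraic_sum H (S P) (\<lambda>i. B i ` carrier (K' i)) =
      algebraic_sum H P (\<lambda>p. algebraic_sum H {1..N p} (\<lambda>i. A p i ` carrier (K p i)))"
    if P: "P \<subseteq> {1..m}" for P
  proof -
    have eq: "(\<lambda>i. B i ` carrier (K' i)) = (\<lambda>(p, i). A p i ` carrier (K p i))"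
      by (auto simp: B_def K'_def)
    show ?thesis unfolding S_def eq
    proof (rule H.algebraic_sum_Sigma)
      show "A p i ` carrier (K p i) \<subseteq> carrier H" if "p \<in> P" "i \<in> {1..N p}" for p i
        using that P by (intro ran) auto
    qed (use finite_subset[OF P] in auto)
  qed
  have family: "hilbert_operator_family H (S P) K' B" if P: "P \<subseteq> {1..m}" for P
    using finite_subset[OF P] P assms(4,5) H.complex_hilbert_space_axioms
    by (auto simp: hilbert_operator_family_def hilbert_operator_family_axioms_def S_def K'_def B_def)
  have "k \<le> m \<Longrightarrow> closedin (norm_topology H) (algebraic_sum H (S {1..k}) (\<lambda>i. B i ` carrier (K' i)))" for k
  proof (induction k)
    \<comment> \<open>Starting from the empty sum, whose only element is zero, makes every group
      enter through \<open>closed_sum_of_families\<close>.\<close>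
    case 0
    have "algebraic_sum H (S {1..0}) (\<lambda>i. B i ` carrier (K' i)) = {\<zero>\<^bsub>H\<^esub>}"
      by (simp add: S_def H.algebraic_sum_empty)
    moreover have "closedin (norm_topology H) {\<zero>\<^bsub>H\<^esub>}"
      by (simp add: norm_topology_def closedin_Hausdorff_sing_eq H.metric.Hausdorff_space_mtopology)
    ultimately show ?case by simp
  next
    case (Suc k)
    have sub: "{1..k} \<subseteq> {1..m}" "{Suc k} \<subseteq> {1..m}" using Suc.prems by auto
    have "closedin (norm_topology H) (algebraic_sum H (S {Suc k}) (\<lambda>i. B i ` carrier (K' i)))"
      unfolding sum[OF sub(2)]
    proof (subst H.algebraic_sum_singleton)
      show "algebraic_sum H {1..N (Suc k)} (\<lambda>i. A (Suc k) i ` carrier (K (Suc k) i)) \<subseteq> carrier H"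
        using Suc.prems by (intro H.algebraic_sum_in_carrier ran) auto
    qed (use assms(7) Suc.prems in auto)
    \<comment> \<open>The first component of \<open>i\<close> is at most \<open>k\<close> and that
      of \<open>j\<close> is \<open>Suc k\<close>, so the hypothesis for distinct groups
      applies.\<close>
    moreover have "compact_operator (K' j) (K' i) (hilbert_adjoint (K' i) H (B i) \<circ> B j)"
      if "i \<in> S {1..k}" "j \<in> S {Suc k}" for i j
      using that assms(6) Suc.prems by (auto simp: S_def K'_def B_def)
    ultimately have "closedin (norm_topology H)
        (algebraic_sum H (S {1..k} \<union> S {Suc k}) (\<lambda>i. B i ` carrier (K' i)))"
      using Suc by (intro H.closed_sum_of_families family sub) (auto simp: S_def)
    moreover have "S {1..k} \<union> S {Suc k} = S {1..Suc k}"
      by (auto simp: S_def le_Suc_eq)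
    ultimately show ?case by simp
  qed
  from this[of m] show ?thesis unfolding sum[OF subset_refl] by simp
qed

end
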